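(* Consider the Gaussian sequence model in which, given $f$, one observes independently $X_k\mid f_k\sim\mathcal N(f_k,1/n)$, $k\ge1$, and write $X^{(n)}=(X_1,X_2,\dots)$. Let $h$ be a probability density on $\mathbb R$ such that: (i) $h$ is symmetric, positive, bounded, and decreasing on $[0,\infty)$; (ii) for some $c_1>0$, $\kappa\ge0$, $\log(1/h(x))\le c_1(1+\log^{1+\kappa}(1+x))$ for all $x\ge0$; (iii) $\int_{-\infty}^\infty x^2h(x)\,dx<\infty$. Let $\Pi$ be the prior on $f=(f_k)_{k\ge1}$ under which $f_k=\sigma_k\zeta_k$ with $(\zeta_k)$ i.i.d. of density $h$ and $\sigma_k=e^{-(\log k)^2}$. Suppose $f_0\in\mathcal S^\beta(L)$ for some $\beta,L>0$. Then there exists $d>0$ such that, with $\mathcal L_n=(\log n)^d$, as $n\to\infty$, $$E_{f_0}\Pi\left[\{f:\ \|f-f_0\|_2>\mathcal L_n\,n^{-\beta/(2\beta+1)}\}\,\middle|\,X^{(n)}\right]\to0.$$ Further, the same result holds, with a possibly different $d$, when instead $\sigma_k=k^{-1/2-\alpha}$ for some $\alpha>0$, provided $\alpha\ge\beta$. Both results also hold for the corresponding priors truncated at $k=n$, i.e. the same priors except that $f_k=0$ for all $k>n$.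
   Context: Functions $f\in L^2[0,1]$ are identified with their coefficient sequences $f_k=\langle f,\varphi_k\rangle$ on a fixed orthonormal basis $\{\varphi_k:k\ge1\}$ of $L^2[0,1]$, so $\|f\|_2^2=\sum_kf_k^2$. The Sobolev-type ball is $\mathcal S^\beta(L)=\{f=(f_k):\ \sum_{k\ge1}k^{2\beta}f_k^2\le L^2\}$. $\Pi[\cdot\mid X^{(n)}]$ is the posterior distribution of $f$ given $X^{(n)}$: since coordinates are independent under both prior and model, under the posterior the $f_k$ are independent, $f_k$ having density proportional to $\theta\mapsto e^{-n(X_k-\theta)^2/2}h(\theta/\sigma_k)$ (and $f_k=0$ for truncated coordinates). $E_{f_0}$ is the expectation when $X_k\sim\mathcal N(f_{0,k},1/n)$ independently. *)

theory Defs
  imports "HOL-Probability.Probability"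
begin

text \<open>Coefficient sequences are functions on nat of which only the coordinates k \<ge> 1 matter:
  measures on sequences live on the index set {1..}, and the series over k \<ge> 1 are written as
  series over j \<ge> 0 with k = Suc j.\<close>

definition sobolev_ball :: "real \<Rightarrow> real \<Rightarrow> (nat \<Rightarrow> real) set" where
  "sobolev_ball \<beta> L =
    {f. summable (\<lambda>j. real (Suc j) powr (2 * \<beta>) * (f (Suc j))\<^sup>2) \<and>
        (\<Sum>j. real (Suc j) powr (2 * \<beta>) * (f (Suc j))\<^sup>2) \<le> L\<^sup>2}"

definition l2_norm :: "(nat \<Rightarrow> real) \<Rightarrow> ereal" where
  "l2_norm f =
    (if summable (\<lambda>j. (f (Suc j))\<^sup>2) then ereal (sqrt (\<Sum>j. (f (Suc j))\<^sup>2)) else \<infinity>)"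

text \<open>The law of the observation under the true sequence. The second parameter of
  \<^const>\<open>normal_density\<close> is the standard deviation.\<close>

definition sequence_model :: "nat \<Rightarrow> (nat \<Rightarrow> real) \<Rightarrow> (nat \<Rightarrow> real) measure" where
  "sequence_model n f =
    (\<Pi>\<^sub>M k\<in>{1..}. density lborel (\<lambda>x. ennreal (normal_density (f k) (1 / sqrt (real n)) x)))"

text \<open>A product prior is given by the family of the laws of its coordinates.\<close>

definition scaled_law :: "(real \<Rightarrow> real) \<Rightarrow> real \<Rightarrow> real measure" where
  "scaled_law h s = distr (density lborel (\<lambda>z. ennreal (h z))) borel (\<lambda>z. s * z)"

definition series_prior :: "(real \<Rightarrow> real) \<Rightarrow> (nat \<Rightarrow> real) \<Rightarrow> nat \<Rightarrow> real measure" where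
  "series_prior h \<sigma> k = scaled_law h (\<sigma> k)"

definition truncated_prior :: "nat \<Rightarrow> (nat \<Rightarrow> real measure) \<Rightarrow> nat \<Rightarrow> real measure" where
  "truncated_prior n \<pi> k = (if k \<le> n then \<pi> k else return borel 0)"

text \<open>Bayes' formula in one coordinate. The factor of the Gaussian likelihood that does not depend
  on the parameter cancels.\<close>

definition coord_posterior :: "nat \<Rightarrow> real measure \<Rightarrow> real \<Rightarrow> real measure" where
  "coord_posterior n \<mu> x =
    density \<mu> (\<lambda>\<theta>. ennreal (exp (- real n * (x - \<theta>)\<^sup>2 / 2)) /
                   (\<integral>\<^sup>+ t. ennreal (exp (- real n * (x - t)\<^sup>2 / 2)) \<partial>\<mu>))"

definition posterior :: "nat \<Rightarrow> (nat \<Rightarrow> real measure) \<Rightarrow> (nat \<Rightarrow> real) \<Rightarrow> (nat \<Rightarrow> real) measure" where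
  "posterior n \<pi> X = (\<Pi>\<^sub>M k\<in>{1..}. coord_posterior n (\<pi> k) (X k))"

definition expected_posterior_mass_outside ::
    "nat \<Rightarrow> (nat \<Rightarrow> real measure) \<Rightarrow> (nat \<Rightarrow> real) \<Rightarrow> real \<Rightarrow> real" where
  "expected_posterior_mass_outside n \<pi> f0 r =
    (\<integral>X. \<P>(f in posterior n \<pi> X. ereal r < l2_norm (\<lambda>k. f k - f0 k)) \<partial>sequence_model n f0)"

text \<open>For untruncated coordinates the posterior has the expected Lebesgue density.\<close>

lemma coord_posterior_scaled_law:
  assumes h[measurable]: "h \<in> borel_measurable borel" and s: "0 < s"
    and hn: "\<And>x. 0 \<le> h x"
  shows "coord_posterior n (scaled_law h s) x =
    density lborel (\<lambda>\<theta>. ennreal (exp (- real n * (x - \<theta>)\<^sup>2 / 2) * h (\<theta> / s)) /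
      (\<integral>\<^sup>+ t. ennreal (exp (- real n * (x - t)\<^sup>2 / 2) * h (t / s)) \<partial>lborel))"
proof -
  define l where "l = (\<lambda>t. exp (- real n * (x - t)\<^sup>2 / 2))"
  have l[measurable]: "l \<in> borel_measurable borel" unfolding l_def by measurable
  have l0: "0 < l t" for t by (simp add: l_def)
  define Z where "Z = (\<integral>\<^sup>+ t. ennreal (l t * h (t / s)) \<partial>lborel)"
  have scaled: "scaled_law h s = density lborel (\<lambda>\<theta>. ennreal (h (\<theta> / s) / s))"
  proof (rule measure_eqI)
    fix A assume "A \<in> sets (scaled_law h s)"
    then have A[measurable]: "A \<in> sets borel" by (simp add: scaled_law_def)
    have "emeasure (scaled_law h s) A
        = (\<integral>\<^sup>+ z. ennreal (h z) * indicator A (s * z) \<partial>lborel)"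
    proof -
      have "emeasure (scaled_law h s) A = emeasure (density lborel (\<lambda>z. ennreal (h z))) ((*) s -` A)"
        by (simp add: scaled_law_def emeasure_distr)
      also have "\<dots> = (\<integral>\<^sup>+ z. ennreal (h z) * indicator ((*) s -` A) z \<partial>lborel)"
        using measurable_sets[of "(*) s" borel borel A] A by (subst emeasure_density) auto
      also have "\<dots> = (\<integral>\<^sup>+ z. ennreal (h z) * indicator A (s * z) \<partial>lborel)"
        by (intro nn_integral_cong) (simp split: split_indicator)
      finally show ?thesis .
    qed
    also have "\<dots> = (\<integral>\<^sup>+ z. ennreal \<bar>s\<bar> * (ennreal (h ((0 + s * z) / s) / s) * indicator A (0 + s * z)) \<partial>lborel)"
      using s hn by (intro nn_integral_cong) (auto simp: ennreal_mult[symmetric] split: split_indicator)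
    also have "\<dots> = (\<integral>\<^sup>+ \<theta>. ennreal (h (\<theta> / s) / s) * indicator A \<theta> \<partial>lborel)"
      using s by (subst (2) nn_integral_real_affine[where c=s and t=0]) (auto simp: nn_integral_cmult)
    also have "\<dots> = emeasure (density lborel (\<lambda>\<theta>. ennreal (h (\<theta> / s) / s))) A"
      by (simp add: emeasure_density)
    finally show "emeasure (scaled_law h s) A = \<dots>" .
  qed (simp add: scaled_law_def)
  have split: "ennreal (h (t / s) / s) * ennreal (l t)
      = ennreal (1 / s) * ennreal (l t * h (t / s))" for t
    using s hn[of "t/s"] l0[of t] by (simp add: ennreal_mult[symmetric] mult_ac)
  have Z': "(\<integral>\<^sup>+ t. ennreal (l t) \<partial>scaled_law h s) = ennreal (1 / s) * Z"
    unfolding scaled Z_def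
    by (subst nn_integral_density) (simp_all add: split nn_integral_cmult)
  have cancel: "ennreal (1 / s) * a / (ennreal (1 / s) * Z) = a / Z" for a :: ennreal
  proof -
    have "ennreal (1 / s) \<noteq> 0" "ennreal (1 / s) \<noteq> top"
      using s by (auto simp: ennreal_eq_0_iff)
    then show ?thesis
      using divide_mult_eq[of "ennreal (1 / s)" a Z] by (simp add: mult.commute)
  qed
  have "coord_posterior n (scaled_law h s) x =
      density (scaled_law h s) (\<lambda>\<theta>. ennreal (l \<theta>) / (ennreal (1 / s) * Z))"
    unfolding Z'[symmetric] coord_posterior_def l_def ..
  also have "\<dots> = density lborel
      (\<lambda>\<theta>. ennreal (h (\<theta> / s) / s) * (ennreal (l \<theta>) / (ennreal (1 / s) * Z)))"
    unfolding scaled by (subst density_density_eq) simp_all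
  also have "\<dots> = density lborel (\<lambda>\<theta>. ennreal (l \<theta> * h (\<theta> / s)) / Z)"
    by (simp add: ennreal_times_divide split cancel)
  finally show ?thesis by (simp add: l_def Z_def)
qed

lemma prob_space_coord_posterior:
  assumes "prob_space \<mu>" and sets: "sets \<mu> = sets borel"
  shows "prob_space (coord_posterior n \<mu> x)"
proof -
  interpret prob_space \<mu> by fact
  have [measurable_cong]: "sets \<mu> = sets borel" by fact
  define Z where "Z = (\<integral>\<^sup>+ t. ennreal (exp (- real n * (x - t)\<^sup>2 / 2)) \<partial>\<mu>)"
  have "Z \<le> (\<integral>\<^sup>+ t. 1 \<partial>\<mu>)" unfolding Z_def by (intro nn_integral_mono) simp
  then have fin: "Z \<noteq> top" by (auto simp: emeasure_space_1 top_unique)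
  have pos: "Z \<noteq> 0"
  proof
    assume "Z = 0"
    then have "AE t in \<mu>. ennreal (exp (- real n * (x - t)\<^sup>2 / 2)) = 0"
      unfolding Z_def by (subst (asm) nn_integral_0_iff_AE) auto
    then show False by (simp add: ennreal_eq_0_iff AE_False not_le)
  qed
  show ?thesis
  proof
    have "emeasure (coord_posterior n \<mu> x) (space (coord_posterior n \<mu> x))
        = (\<integral>\<^sup>+ t. ennreal (exp (- real n * (x - t)\<^sup>2 / 2)) / Z \<partial>\<mu>)"
      unfolding coord_posterior_def Z_def[symmetric]
      by (subst emeasure_density) (auto intro!: nn_integral_cong)
    also have "\<dots> = Z / Z" unfolding Z_def by (rule nn_integral_divide) simp
    also have "\<dots> = 1" using fin pos by (simp add: less_top)
    finally show "emeasure (coord_posterior n \<mu> x) (space (coord_posterior n \<mu> x)) = 1" .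
  qed
qed

lemma sets_coord_posterior [simp, measurable_cong]:
  "sets (coord_posterior n \<mu> x) = sets \<mu>"
  by (simp add: coord_posterior_def)

lemma coord_posterior_return_0: "coord_posterior n (return borel 0) x = return borel 0"
proof (rule measure_eqI)
  fix A :: "real set" assume "A \<in> sets (coord_posterior n (return borel 0) x)"
  then have [measurable]: "A \<in> sets borel" by simp
  have "ennreal (exp (- real n * (x - 0)\<^sup>2 / 2)) / ennreal (exp (- real n * (x - 0)\<^sup>2 / 2)) = 1"
    by (subst divide_ennreal) auto
  then show "emeasure (coord_posterior n (return borel 0) x) A = emeasure (return borel 0) A"
    unfolding coord_posterior_def
    by (subst emeasure_density) (auto simp: nn_integral_return split: split_indicator)
qed simp

lemma coord_posterior_measurable:
  assumes "prob_space \<mu>" and sets: "sets \<mu> = sets borel"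
  shows "coord_posterior n \<mu> \<in> borel \<rightarrow>\<^sub>M prob_algebra borel"
proof (rule measurable_prob_algebra_generated[where \<Omega>=UNIV and G="sets borel"])
  interpret prob_space \<mu> by fact
  have [measurable_cong]: "sets \<mu> = sets borel" by fact
  fix A :: "real set" assume A[measurable]: "A \<in> sets borel"
  show "(\<lambda>x. emeasure (coord_posterior n \<mu> x) A) \<in> borel_measurable borel"
    unfolding coord_posterior_def
    by (subst emeasure_density) (auto simp: sets intro!: borel_measurable_nn_integral)
qed (auto simp: sets prob_space_coord_posterior assms sets.Int_stable
        sets.sigma_sets_eq[of borel, simplified])

lemma posterior_measurable:
  assumes p: "\<And>k. 1 \<le> k \<Longrightarrow> prob_space (\<pi> k)"
    and sets: "\<And>k. 1 \<le> k \<Longrightarrow> sets (\<pi> k) = sets borel"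
  shows "posterior n \<pi> \<in> (\<Pi>\<^sub>M k\<in>{1..}. borel) \<rightarrow>\<^sub>M prob_algebra (\<Pi>\<^sub>M k\<in>{1..}. borel)"
proof (rule measurable_prob_algebra_generated[OF sets_PiM Int_stable_prod_algebra prod_algebra_sets_into_space])
  let ?B = "\<lambda>_::nat. borel :: real measure"
  define K where "K = (\<lambda>k x. if 1 \<le> k then coord_posterior n (\<pi> k) x else return borel 0)"
  have Kp: "prob_space (K k x)" for k x
    using p sets by (auto simp: K_def prob_space_coord_posterior prob_space_return)
  have Ks[simp]: "sets (K k x) = sets borel" for k x
    using sets by (simp add: K_def)
  have post: "posterior n \<pi> X = (\<Pi>\<^sub>M k\<in>{1..}. K k (X k))" for X
    unfolding posterior_def by (rule PiM_cong) (auto simp: K_def)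
  have P: "product_prob_space (\<lambda>k. K k (X k))" for X :: "nat \<Rightarrow> real"
    using Kp by (simp add: product_prob_space_def product_prob_space_axioms_def
        product_sigma_finite_def prob_space_imp_sigma_finite)
  show "prob_space (posterior n \<pi> X)" for X
    unfolding post by (rule prob_space_PiM) (rule Kp)
  show "sets (posterior n \<pi> X) = sets (Pi\<^sub>M {1..} ?B)" for X
    unfolding post by (rule sets_PiM_cong) auto
  fix A assume "A \<in> prod_algebra {1..} ?B"
  then obtain J E where A: "A = prod_emb {1..} ?B J (Pi\<^sub>E J E)" and J: "finite J" "J \<subseteq> {1..}"
    and E: "\<And>i. i \<in> J \<Longrightarrow> E i \<in> sets borel"
    by (elim prod_algebraE) auto
  have "emeasure (posterior n \<pi> X) A = (\<Prod>i\<in>J. emeasure (K i (X i)) (E i))" for X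
  proof -
    have "A = prod_emb {1..} (\<lambda>k. K k (X k)) J (Pi\<^sub>E J E)"
      unfolding A prod_emb_def using sets_eq_imp_space_eq[OF Ks] by simp
    then show ?thesis
      unfolding post using product_prob_space.emeasure_PiM_emb[OF P J(2,1), of E X] E by simp
  qed
  moreover have "(\<lambda>X. emeasure (K i (X i)) (E i)) \<in> borel_measurable (Pi\<^sub>M {1..} ?B)"
    if "i \<in> J" for i
  proof -
    have i: "1 \<le> i" using that J by auto
    have [measurable]: "K i \<in> borel \<rightarrow>\<^sub>M prob_algebra borel"
      using coord_posterior_measurable[OF p[OF i] sets[OF i], of n] i by (simp add: K_def cong: measurable_cong)
    have [measurable]: "E i \<in> sets borel" using E that by simp
    have [measurable]: "(\<lambda>X. X i) \<in> Pi\<^sub>M {1..} ?B \<rightarrow>\<^sub>M borel"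
      using i by (intro measurable_component_singleton) auto
    have "(\<lambda>x. emeasure (K i x) (E i)) \<in> borel_measurable borel"
      by (rule measurable_compose[OF measurable_prob_algebraD measurable_emeasure_subprob_algebra])
        fact+
    then show ?thesis by measurable
  qed
  ultimately show "(\<lambda>X. emeasure (posterior n \<pi> X) A) \<in> borel_measurable (Pi\<^sub>M {1..} ?B)"
    by (simp add: borel_measurable_prod)
qed

lemma l2_norm_measurable:
  "(\<lambda>f. l2_norm (\<lambda>k. f k - f0 k)) \<in> borel_measurable (\<Pi>\<^sub>M k\<in>{1..}. borel)"
proof -
  have [measurable]: "(\<lambda>f. f (Suc j)) \<in> (\<Pi>\<^sub>M k\<in>{1..}. borel) \<rightarrow>\<^sub>M (borel :: real measure)" for j
    by (intro measurable_component_singleton) auto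
  have "summable (\<lambda>j. (f (Suc j) - f0 (Suc j))\<^sup>2)
      \<longleftrightarrow> Cauchy (\<lambda>m. \<Sum>j<m. (f (Suc j) - f0 (Suc j))\<^sup>2)" for f :: "nat \<Rightarrow> real"
    by (simp add: summable_iff_convergent Cauchy_convergent_iff)
  then show ?thesis unfolding l2_norm_def using sets_Collect_Cauchy by simp measurable
qed

lemma sets_scaled_law [simp, measurable_cong]: "sets (scaled_law h s) = sets borel"
  by (simp add: scaled_law_def)

lemma prob_space_scaled_law:
  assumes [measurable]: "h \<in> borel_measurable borel"
    and h1: "(\<integral>\<^sup>+ x. ennreal (h x) \<partial>lborel) = 1"
  shows "prob_space (scaled_law h s)"
  unfolding scaled_law_def
  by (intro prob_space.prob_space_distr prob_spaceI) (auto simp: emeasure_density h1)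

text \<open>In particular the Bochner integral in \<^const>\<open>expected_posterior_mass_outside\<close> is the integral of
  a measurable function with values in [0, 1].\<close>

lemma posterior_mass_measurable:
  assumes p: "\<And>k. 1 \<le> k \<Longrightarrow> prob_space (\<pi> k)"
    and sets: "\<And>k. 1 \<le> k \<Longrightarrow> sets (\<pi> k) = sets borel"
  shows "(\<lambda>X. \<P>(f in posterior n \<pi> X. ereal r < l2_norm (\<lambda>k. f k - f0 k)))
    \<in> borel_measurable (sequence_model n f0)"
proof -
  let ?M = "(\<Pi>\<^sub>M k\<in>{1..}. borel) :: (nat \<Rightarrow> real) measure"
  let ?A = "{f \<in> space ?M. ereal r < l2_norm (\<lambda>k. f k - f0 k)}"
  note l2_norm_measurable[measurable]
  have A: "?A \<in> sets ?M" by measurable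
  have K: "posterior n \<pi> \<in> ?M \<rightarrow>\<^sub>M prob_algebra ?M"
    using p sets by (rule posterior_measurable)
  have sm: "sets (sequence_model n f0) = sets ?M"
    unfolding sequence_model_def by (rule sets_PiM_cong) auto
  have sp: "space (posterior n \<pi> X) = space ?M" for X
    unfolding posterior_def space_PiM
    by (rule PiE_cong) (simp add: coord_posterior_def sets_eq_imp_space_eq[OF sets])
  have "(\<lambda>X. measure (posterior n \<pi> X) ?A) \<in> borel_measurable ?M"
    using A K by (intro measurable_compose[OF measurable_prob_algebraD measurable_measure_subprob_algebra]) 
  then show ?thesis
    by (simp add: sp measurable_cong_sets[OF sm refl])
qed

end

theory Submission
  imports Defs
begin

text \<open>By Markov's inequality it suffices to bound the posterior second moments around f0,
  coordinate by coordinate, in expectation. Two bounds are available. First, the normalising constant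
  of the posterior is at least the prior mass of the noise-sized ball around the true parameter, up to
  the likelihood of that ball; together with y \<le> M + exp (y - M) this gives a risk of order 1/n times
  the log of the inverse prior mass, which for log-polynomial tails of the density is polylogarithmic
  in n and k. Second, for a parameter below the noise level, symmetry of the prior bounds the
  normalising constant from below by the likelihood at 0, so that the risk is at most the prior variance
  times a logarithm. The first bound is used up to k = n powr (1 / (2 * \<beta> + 1)) and whenever
  f0 k exceeds the noise level up to a logarithm (so that 1/n is at most (f0 k)^2 times a logarithm),
  and the second one for the remaining coordinates.\<close>

text \<open>The obstacle lies in the second bound. It carries the factor exp (n x^2 / 2), which
  cancels the Gaussian decay of the noise exactly, so its expectation over all x is infinite.
  Restricting x to T noise standard deviations around the parameter makes it finite at the price of
  a factor T. Off this window the first bound takes over: it grows only linearly in n (x - a)^2 and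
  is paid for by a Gaussian tail. Choosing T^2 proportional to 1 + ln n + ln k pushes that tail
  below k powr (- 1 - 2 * \<beta>), the order of the prior variance, while T itself remains
  logarithmic. A second obstacle is that ln k is unbounded along the series and cannot be replaced
  by ln n. With K the cutoff, ln k = ln K + ln (k / K), and powers of 1 + ln (k / K) are at most a
  constant times (k / K) powr \<beta>. Both the Sobolev weights and the prior variances have this
  much decay to spare beyond K. The rate appears because K = n powr (1 / (2 * \<beta> + 1))
  satisfies K / n = K powr (- 2 * \<beta>): the risk 1/n of the low frequencies balances the squared
  tail of the Sobolev ball.\<close>

section \<open>Pointwise bounds for the posterior of one coordinate\<close>

lemma nn_integral_coord_posterior:
  assumes "prob_space \<mu>" and sets: "sets \<mu> = sets borel" and g[measurable]: "g \<in> borel_measurable borel"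
  shows "(\<integral>\<^sup>+ \<theta>. g \<theta> \<partial>coord_posterior n \<mu> x) =
    (\<integral>\<^sup>+ \<theta>. g \<theta> * ennreal (exp (- real n * (x - \<theta>)\<^sup>2 / 2)) \<partial>\<mu>) /
    (\<integral>\<^sup>+ \<theta>. ennreal (exp (- real n * (x - \<theta>)\<^sup>2 / 2)) \<partial>\<mu>)"
proof -
  have [measurable_cong]: "sets \<mu> = sets borel" by fact
  define Z where "Z = (\<integral>\<^sup>+ t. ennreal (exp (- real n * (x - t)\<^sup>2 / 2)) \<partial>\<mu>)"
  show ?thesis
    unfolding coord_posterior_def Z_def[symmetric]
    by (subst nn_integral_density)
       (auto simp: ennreal_times_divide mult.commute nn_integral_divide intro!: nn_integral_cong)
qed

text \<open>The part of \<open>g\<close> dominated by a constant multiple of the likelihood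
  integrates to \<open>A\<close> times the normalising constant and survives as \<open>A\<close>.
  The remainder \<open>u\<close> is integrated against the prior, and only it pays the factor
  1/\<delta> for the lower bound on the normalising constant. Both moment bounds below are instances
  with different \<open>u\<close>.\<close>

lemma posterior_mean_le:
  assumes "prob_space \<mu>" and sets: "sets \<mu> = sets borel" and g[measurable]: "g \<in> borel_measurable borel"
    and D: "ennreal \<delta> \<le> (\<integral>\<^sup>+ \<theta>. ennreal (exp (- real n * (x - \<theta>)\<^sup>2 / 2)) \<partial>\<mu>)"
    and A: "0 \<le> A" and \<delta>: "0 < \<delta>" and B: "0 \<le> B" "\<And>\<theta>. 0 \<le> u \<theta>" "u \<in> borel_measurable borel"
    and u: "(\<integral>\<^sup>+ \<theta>. ennreal (u \<theta>) \<partial>\<mu>) \<le> ennreal B"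
    and le: "\<And>\<theta>. g \<theta> * exp (- real n * (x - \<theta>)\<^sup>2 / 2) \<le> A * exp (- real n * (x - \<theta>)\<^sup>2 / 2) + u \<theta>"
  shows "(\<integral>\<^sup>+ \<theta>. ennreal (g \<theta>) \<partial>coord_posterior n \<mu> x) \<le> ennreal (A + B / \<delta>)"
proof -
  interpret prob_space \<mu> by fact
  note B(3)[measurable]
  have [measurable_cong]: "sets \<mu> = sets borel" by fact
  let ?e = "\<lambda>\<theta>. exp (- real n * (x - \<theta>)\<^sup>2 / 2)"
  define Z where "Z = (\<integral>\<^sup>+ t. ennreal (?e t) \<partial>\<mu>)"
  have "Z \<le> (\<integral>\<^sup>+ t. 1 \<partial>\<mu>)" unfolding Z_def by (intro nn_integral_mono) simp
  then have fin: "Z \<noteq> top" by (auto simp: emeasure_space_1 top_unique)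
  have pos: "Z \<noteq> 0" using D \<delta> unfolding Z_def[symmetric] by (auto simp: ennreal_eq_0_iff)
  have "(\<integral>\<^sup>+ \<theta>. ennreal (g \<theta>) * ennreal (?e \<theta>) \<partial>\<mu>) \<le> (\<integral>\<^sup>+ \<theta>. ennreal A * ennreal (?e \<theta>) + ennreal (u \<theta>) \<partial>\<mu>)"
    using le A B(2)
    by (intro nn_integral_mono)
       (metis ennreal_leI ennreal_mult' ennreal_mult'' ennreal_plus exp_ge_zero mult_nonneg_nonneg)
  also have "\<dots> = ennreal A * Z + (\<integral>\<^sup>+ \<theta>. ennreal (u \<theta>) \<partial>\<mu>)"
    unfolding Z_def by (subst nn_integral_add) (auto simp: nn_integral_cmult)
  also have "\<dots> \<le> ennreal A * Z + ennreal B" using u by (intro add_left_mono)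
  also have "\<dots> \<le> ennreal A * Z + ennreal (B / \<delta>) * Z"
  proof (intro add_left_mono)
    have "ennreal B = ennreal (B / \<delta>) * ennreal \<delta>" using \<delta> B by (simp add: ennreal_mult[symmetric])
    also have "\<dots> \<le> ennreal (B / \<delta>) * Z" using D unfolding Z_def by (intro mult_left_mono) auto
    finally show "ennreal B \<le> ennreal (B / \<delta>) * Z" .
  qed
  also have "\<dots> = ennreal (A + B / \<delta>) * Z"
    using A B \<delta> by (simp add: distrib_right ennreal_plus)
  finally have *: "(\<integral>\<^sup>+ \<theta>. ennreal (g \<theta>) * ennreal (?e \<theta>) \<partial>\<mu>) \<le> ennreal (A + B / \<delta>) * Z" .
  have "(\<integral>\<^sup>+ \<theta>. ennreal (g \<theta>) \<partial>coord_posterior n \<mu> x) = (\<integral>\<^sup>+ \<theta>. ennreal (g \<theta>) * ennreal (?e \<theta>) \<partial>\<mu>) / Z"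
    using nn_integral_coord_posterior[OF assms(1) sets, of "\<lambda>\<theta>. ennreal (g \<theta>)" n x] unfolding Z_def by simp
  also have "\<dots> \<le> ennreal (A + B / \<delta>) * Z / Z" by (rule divide_right_mono_ennreal[OF *])
  also have "\<dots> = ennreal (A + B / \<delta>)"
    using pos fin by (simp add: ennreal_times_divide[symmetric] less_top)
  finally show ?thesis .
qed

lemma posterior_second_moment_le:
  assumes "prob_space \<mu>" and sets: "sets \<mu> = sets borel" and n: "0 < n"
    and m: "0 < m" "m \<le> measure \<mu> {\<theta>. \<bar>\<theta> - a\<bar> \<le> 1 / sqrt (real n)}"
  shows "(\<integral>\<^sup>+ \<theta>. ennreal ((\<theta> - a)\<^sup>2) \<partial>coord_posterior n \<mu> x)
    \<le> ennreal ((16 + 8 * ln (1 / m) + 10 * (real n * (x - a)\<^sup>2)) / real n)"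
proof -
  interpret prob_space \<mu> by fact
  have [measurable_cong]: "sets \<mu> = sets borel" by fact
  let ?w = "real n * (x - a)\<^sup>2"
  let ?S = "{\<theta>. \<bar>\<theta> - a\<bar> \<le> 1 / sqrt (real n)}"
  \<comment> \<open>On the ball, n (x - \<theta>)^2 / 2 is at most n (x - a)^2 + n (\<theta> - a)^2,
    hence at most \<open>?w + 1\<close>; \<delta> is the resulting lower bound for the normalising
    constant, and \<open>M\<close> below is - ln \<delta>.\<close>
  define \<delta> where "\<delta> = m * exp (- ?w - 1)"
  define M where "M = ln (1 / m) + ?w + 1"
  have m1: "m \<le> 1" using m(2) prob_le_1[of ?S] by linarith
  have \<delta>0: "0 < \<delta>" using m by (simp add: \<delta>_def)
  have "ln m \<le> 0" using m m1 by simp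
  then have M0: "0 \<le> M" using m unfolding M_def by (intro add_nonneg_nonneg) (auto simp: ln_div)
  have \<delta>M: "\<delta> = exp (- M)" using m by (simp add: \<delta>_def M_def ln_div exp_add exp_minus exp_diff field_simps)
  have D: "ennreal \<delta> \<le> (\<integral>\<^sup>+ \<theta>. ennreal (exp (- real n * (x - \<theta>)\<^sup>2 / 2)) \<partial>\<mu>)"
  proof -
    have "ennreal \<delta> \<le> ennreal (exp (- ?w - 1) * measure \<mu> ?S)"
      using m by (intro ennreal_leI) (simp add: \<delta>_def)
    also have "\<dots> = ennreal (exp (- ?w - 1)) * emeasure \<mu> ?S"
      by (simp add: ennreal_mult emeasure_eq_measure)
    also have "\<dots> = (\<integral>\<^sup>+ \<theta>. ennreal (exp (- ?w - 1)) * indicator ?S \<theta> \<partial>\<mu>)"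
      by (subst nn_integral_cmult_indicator) auto
    also have "\<dots> \<le> (\<integral>\<^sup>+ \<theta>. ennreal (exp (- real n * (x - \<theta>)\<^sup>2 / 2)) \<partial>\<mu>)"
    proof (intro nn_integral_mono)
      fix \<theta>
      have "real n * (x - \<theta>)\<^sup>2 / 2 \<le> ?w + 1" if "\<theta> \<in> ?S"
      proof -
        have "(\<theta> - a)\<^sup>2 \<le> (1 / sqrt (real n))\<^sup>2" using that by (intro abs_le_square_iff[THEN iffD1]) auto
        then have 1: "real n * (\<theta> - a)\<^sup>2 \<le> 1" using n by (simp add: power_divide field_simps)
        have "(x - \<theta>)\<^sup>2 \<le> 2 * (x - a)\<^sup>2 + 2 * (\<theta> - a)\<^sup>2"
          using zero_le_power2[of "x + \<theta> - 2 * a"] by (simp add: power2_eq_square algebra_simps)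
        then have "real n * (x - \<theta>)\<^sup>2 \<le> real n * (2 * (x - a)\<^sup>2 + 2 * (\<theta> - a)\<^sup>2)"
          by (intro mult_left_mono) auto
        then show ?thesis using 1 by (simp add: algebra_simps)
      qed
      then show "ennreal (exp (- ?w - 1)) * indicator ?S \<theta> \<le> ennreal (exp (- real n * (x - \<theta>)\<^sup>2 / 2))"
        by (auto split: split_indicator intro!: ennreal_leI)
    qed
    finally show ?thesis .
  qed
  have "(\<integral>\<^sup>+ \<theta>. ennreal ((\<theta> - a)\<^sup>2) \<partial>coord_posterior n \<mu> x)
     \<le> ennreal ((8 * M + 2 * ?w) / real n + (8 * \<delta> / real n) / \<delta>)"
  \<comment> \<open>The remainder is chosen proportional to \<delta>, so that dividing by the lower
    bound \<delta> leaves only 8 / n.\<close>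
  proof (rule posterior_mean_le[OF assms(1) sets, where u="\<lambda>_. 8 * \<delta> / real n"])
    show "(\<theta> - a)\<^sup>2 * exp (- real n * (x - \<theta>)\<^sup>2 / 2)
      \<le> (8 * M + 2 * ?w) / real n * exp (- real n * (x - \<theta>)\<^sup>2 / 2) + 8 * \<delta> / real n" for \<theta>
    proof -
      \<comment> \<open>With this scaling the likelihood is exp (- 2 y). In y \<le> M + exp (y - M)
        the exponential uses up half of it, and exp (- y) remains to keep the remainder below
        \<delta> for every \<theta>.\<close>
      define y where "y = real n * (x - \<theta>)\<^sup>2 / 4"
      have "y - M \<le> exp (y - M)" using exp_ge_add_one_self[of "y - M"] by linarith
      then have "y * exp (- 2 * y) \<le> (M + exp (y - M)) * exp (- 2 * y)" by (intro mult_right_mono) auto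
      also have "\<dots> = M * exp (- 2 * y) + \<delta> * exp (- y)"
        by (simp add: \<delta>M distrib_right mult_exp_exp)
      also have "\<delta> * exp (- y) \<le> \<delta>" using \<delta>0 by (simp add: y_def mult_le_cancel_left1)
      finally have y: "y * exp (- 2 * y) \<le> M * exp (- 2 * y) + \<delta>" by simp
      have "(\<theta> - a)\<^sup>2 \<le> 2 * (x - a)\<^sup>2 + 2 * (x - \<theta>)\<^sup>2"
        using zero_le_power2[of "2 * x - \<theta> - a"] by (simp add: power2_eq_square algebra_simps)
      then have "real n * (\<theta> - a)\<^sup>2 \<le> real n * (2 * (x - a)\<^sup>2 + 2 * (x - \<theta>)\<^sup>2)" 
        by (intro mult_left_mono) auto
      then have "real n * (\<theta> - a)\<^sup>2 \<le> 8 * y + 2 * ?w" by (simp add: y_def algebra_simps)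
      then have "real n * (\<theta> - a)\<^sup>2 * exp (- 2 * y) \<le> (8 * y + 2 * ?w) * exp (- 2 * y)" 
        by (intro mult_right_mono) auto
      also have "\<dots> \<le> (8 * M + 2 * ?w) * exp (- 2 * y) + 8 * \<delta>"
        using y by (simp add: algebra_simps)
      finally have "(\<theta> - a)\<^sup>2 * exp (- 2 * y) \<le> ((8 * M + 2 * ?w) * exp (- 2 * y) + 8 * \<delta>) / real n"
        using n by (simp add: pos_le_divide_eq mult_ac)
      moreover have "- 2 * y = - real n * (x - \<theta>)\<^sup>2 / 2" by (simp add: y_def)
      moreover have "(p * q + r) / s = p / s * q + r / s" for p q r s :: real
        by (simp add: add_divide_distrib)
      ultimately show ?thesis by (simp only:)
    qed
  qed (use D \<delta>0 M0 in \<open>auto simp: emeasure_space_1\<close>)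
  also have "(8 * M + 2 * ?w) / real n + (8 * \<delta> / real n) / \<delta> = (16 + 8 * ln (1 / m) + 10 * ?w) / real n"
    using \<delta>0 n by (simp add: M_def field_simps)
  finally show ?thesis .
qed

text \<open>Averaging the likelihood over \<theta> and - \<theta> replaces the cross term exp (n x
  \<theta>) by cosh (n x \<theta>) \<ge> 1, so the normalising constant is at least \<open>c\<close>
  times the likelihood exp (- n x^2 / 2) of the parameter 0. In the numerator (\<theta> - a)^2 \<le>
  2 a^2 + 2 \<theta>^2, and the likelihood in front of \<theta>^2 is simply bounded by 1, which
  leaves the prior variance.\<close>

lemma posterior_second_moment_symmetric_le:
  assumes "prob_space \<mu>" and sets: "sets \<mu> = sets borel"
    and sym: "distr \<mu> borel uminus = \<mu>"
    and c: "0 < c" "ennreal c \<le> (\<integral>\<^sup>+ \<theta>. ennreal (exp (- real n * \<theta>\<^sup>2 / 2)) \<partial>\<mu>)"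
    and v: "0 \<le> v" "(\<integral>\<^sup>+ \<theta>. ennreal (\<theta>\<^sup>2) \<partial>\<mu>) \<le> ennreal v"
  shows "(\<integral>\<^sup>+ \<theta>. ennreal ((\<theta> - a)\<^sup>2) \<partial>coord_posterior n \<mu> x)
    \<le> ennreal (2 * a\<^sup>2 + 2 * v / c * exp (real n * x\<^sup>2 / 2))"
proof -
  interpret prob_space \<mu> by fact
  have [measurable_cong]: "sets \<mu> = sets borel" by fact
  let ?e = "\<lambda>x \<theta>. exp (- real n * (x - \<theta>)\<^sup>2 / 2)"
  define \<delta> where "\<delta> = c * exp (- real n * x\<^sup>2 / 2)"
  have \<delta>0: "0 < \<delta>" using c by (simp add: \<delta>_def)
  have D: "ennreal \<delta> \<le> (\<integral>\<^sup>+ \<theta>. ennreal (?e x \<theta>) \<partial>\<mu>)"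
  proof -
    have "(\<integral>\<^sup>+ \<theta>. ennreal (?e x \<theta>) \<partial>\<mu>) = (\<integral>\<^sup>+ \<theta>. ennreal (?e x \<theta>) \<partial>distr \<mu> borel uminus)"
      by (simp add: sym)
    also have "\<dots> = (\<integral>\<^sup>+ \<theta>. ennreal (?e x (- \<theta>)) \<partial>\<mu>)" by (rule nn_integral_distr) auto
    finally have eq: "(\<integral>\<^sup>+ \<theta>. ennreal (?e x (- \<theta>)) \<partial>\<mu>) = (\<integral>\<^sup>+ \<theta>. ennreal (?e x \<theta>) \<partial>\<mu>)" by simp
    have "2 * ennreal \<delta> = ennreal (2 * exp (- real n * x\<^sup>2 / 2)) * ennreal c"
      using c by (simp add: \<delta>_def ennreal_mult mult_ac)
    also have "\<dots> \<le> ennreal (2 * exp (- real n * x\<^sup>2 / 2)) * (\<integral>\<^sup>+ \<theta>. ennreal (exp (- real n * \<theta>\<^sup>2 / 2)) \<partial>\<mu>)"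
      by (intro mult_left_mono c) auto
    also have "\<dots> = (\<integral>\<^sup>+ \<theta>. ennreal (2 * exp (- real n * x\<^sup>2 / 2)) * ennreal (exp (- real n * \<theta>\<^sup>2 / 2)) \<partial>\<mu>)"
      by (subst nn_integral_cmult) auto
    also have "\<dots> \<le> (\<integral>\<^sup>+ \<theta>. ennreal (?e x \<theta>) + ennreal (?e x (- \<theta>)) \<partial>\<mu>)"
    proof (intro nn_integral_mono)
      fix \<theta>
      let ?u = "real n * x * \<theta>"
      let ?q = "exp (- real n * x\<^sup>2 / 2) * exp (- real n * \<theta>\<^sup>2 / 2)"
      have "2 \<le> exp ?u + exp (- ?u)"
        using exp_ge_add_one_self[of ?u] exp_ge_add_one_self[of "- ?u"] by linarith
      then have "?q * 2 \<le> ?q * (exp ?u + exp (- ?u))" by (intro mult_left_mono) auto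
      also have "\<dots> = ?e x \<theta> + ?e x (- \<theta>)"
      proof -
        have "?q * exp ?u = ?e x \<theta>" "?q * exp (- ?u) = ?e x (- \<theta>)"
          unfolding mult_exp_exp by (rule arg_cong[of _ _ exp], simp add: power2_eq_square field_simps)+
        then show ?thesis by (simp add: distrib_left)
      qed
      finally have "2 * exp (- real n * x\<^sup>2 / 2) * exp (- real n * \<theta>\<^sup>2 / 2) \<le> ?e x \<theta> + ?e x (- \<theta>)"
        by (simp add: mult_ac)
      from ennreal_leI[OF this] show "ennreal (2 * exp (- real n * x\<^sup>2 / 2)) * ennreal (exp (- real n * \<theta>\<^sup>2 / 2))
          \<le> ennreal (?e x \<theta>) + ennreal (?e x (- \<theta>))"
        by (simp add: ennreal_mult ennreal_plus)
    qed
    also have "\<dots> = (\<integral>\<^sup>+ \<theta>. ennreal (?e x \<theta>) \<partial>\<mu>) + (\<integral>\<^sup>+ \<theta>. ennreal (?e x (- \<theta>)) \<partial>\<mu>)"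
      by (rule nn_integral_add) auto
    also have "\<dots> = 2 * (\<integral>\<^sup>+ \<theta>. ennreal (?e x \<theta>) \<partial>\<mu>)"
      unfolding eq by (simp add: mult_2)
    finally show ?thesis
      by (simp add: ennreal_mult_le_mult_iff)
  qed
  have "(\<integral>\<^sup>+ \<theta>. ennreal ((\<theta> - a)\<^sup>2) \<partial>coord_posterior n \<mu> x) \<le> ennreal (2 * a\<^sup>2 + 2 * v / \<delta>)"
  proof (rule posterior_mean_le[OF assms(1) sets, where u="\<lambda>\<theta>. 2 * \<theta>\<^sup>2"])
    show "(\<integral>\<^sup>+ \<theta>. ennreal (2 * \<theta>\<^sup>2) \<partial>\<mu>) \<le> ennreal (2 * v)"
      using v(2) by (simp add: ennreal_mult nn_integral_cmult v mult_left_mono)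
    show "(\<theta> - a)\<^sup>2 * ?e x \<theta> \<le> 2 * a\<^sup>2 * ?e x \<theta> + 2 * \<theta>\<^sup>2" for \<theta>
    proof -
      have "(\<theta> - a)\<^sup>2 \<le> 2 * a\<^sup>2 + 2 * \<theta>\<^sup>2"
        using zero_le_power2[of "\<theta> + a"] by (simp add: power2_eq_square algebra_simps)
      then have "(\<theta> - a)\<^sup>2 * ?e x \<theta> \<le> (2 * a\<^sup>2 + 2 * \<theta>\<^sup>2) * ?e x \<theta>" by (intro mult_right_mono) auto
      also have "\<dots> \<le> 2 * a\<^sup>2 * ?e x \<theta> + 2 * \<theta>\<^sup>2"
        by (simp add: distrib_right mult_left_le)
      finally show ?thesis .
    qed
  qed (use D \<delta>0 v in auto)
  also have "2 * v / \<delta> = 2 * v / c * exp (real n * x\<^sup>2 / 2)"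
    by (simp add: \<delta>_def exp_minus field_simps)
  finally show ?thesis .
qed

section \<open>Risk of one coordinate, averaged over the noise\<close>

text \<open>The mean squared error of a draw from the posterior when the data come from
  \<open>a\<close>. Values in \<open>ennreal\<close> allow summation over all coordinates without
  integrability conditions.\<close>

definition coord_risk :: "nat \<Rightarrow> real measure \<Rightarrow> real \<Rightarrow> ennreal" where
  "coord_risk n \<mu> a =
    (\<integral>\<^sup>+ x. (\<integral>\<^sup>+ \<theta>. ennreal ((\<theta> - a)\<^sup>2) \<partial>coord_posterior n \<mu> x)
      \<partial>density lborel (\<lambda>x. ennreal (normal_density a (1 / sqrt (real n)) x)))"

lemma prob_space_normal:
  "0 < n \<Longrightarrow> prob_space (density lborel (\<lambda>x. ennreal (normal_density a (1 / sqrt (real n)) x)))"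
  by (rule prob_space_normal_density) simp

lemma nn_integral_normal_square:
  assumes n: "0 < n" and A: "0 \<le> A" and B: "0 \<le> B"
  shows "(\<integral>\<^sup>+ x. ennreal (A + B * (real n * (x - a)\<^sup>2))
    \<partial>density lborel (\<lambda>x. ennreal (normal_density a (1 / sqrt (real n)) x))) = ennreal (A + B)"
proof -
  let ?p = "normal_density a (1 / sqrt (real n))"
  have s: "0 < 1 / sqrt (real n)" using n by simp
  have "has_bochner_integral lborel (\<lambda>x. A * ?p x + B * real n * (?p x * (x - a) ^ (2 * 1)))
     (A * 1 + B * real n * (fact (2 * 1) / ((2 / (1 / sqrt (real n))\<^sup>2) ^ 1 * fact 1)))"
    using s by (intro has_bochner_integral_add has_bochner_integral_mult_right normal_moment_even)
      (auto simp: has_bochner_integral_iff)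
  then have *: "has_bochner_integral lborel (\<lambda>x. ?p x * (A + B * (real n * (x - a)\<^sup>2))) (A + B)"
    using n by (simp add: distrib_left mult_ac power_divide)
  have "(\<integral>\<^sup>+ x. ennreal (A + B * (real n * (x - a)\<^sup>2)) \<partial>density lborel (\<lambda>x. ennreal (?p x)))
     = (\<integral>\<^sup>+ x. ennreal (?p x * (A + B * (real n * (x - a)\<^sup>2))) \<partial>lborel)"
    using A B s by (subst nn_integral_density) (auto simp: ennreal_mult)
  also have "\<dots> = ennreal (A + B)"
    using A B * by (subst nn_integral_eq_integral) (auto simp: has_bochner_integral_iff)
  finally show ?thesis .
qed

text \<open>The exponential halves the Gaussian exponent, which gives sqrt 2 times the density of
  doubled variance; the exact value is sqrt 2. The coefficient 1/4 is half of the critical 1/2, at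
  which the integral diverges.\<close>

lemma nn_integral_normal_exp_square:
  assumes n: "0 < n"
  shows "(\<integral>\<^sup>+ x. ennreal (exp (real n * (x - a)\<^sup>2 / 4))
    \<partial>density lborel (\<lambda>x. ennreal (normal_density a (1 / sqrt (real n)) x))) \<le> 2"
proof -
  let ?p = "normal_density a (1 / sqrt (real n))"
  let ?q = "normal_density a (sqrt 2 / sqrt (real n))"
  have s: "0 < 1 / sqrt (real n)" "0 < sqrt 2 / sqrt (real n)" using n by simp_all
  have eq: "?p x * exp (real n * (x - a)\<^sup>2 / 4) = sqrt 2 * ?q x" for x
  proof -
    have "exp (- (real n * (x - a)\<^sup>2 / 2)) * exp (real n * (x - a)\<^sup>2 / 4) = exp (- (real n * (x - a)\<^sup>2 / 4))"
      by (simp add: mult_exp_exp)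
    moreover have "sqrt 2 * (sqrt 2 * y) = 2 * y" for y
      by (simp add: mult.assoc[symmetric])
    ultimately show ?thesis
      using n by (simp add: normal_density_def power_divide real_sqrt_mult real_sqrt_divide field_simps)
  qed
  have "(\<integral>\<^sup>+ x. ennreal (exp (real n * (x - a)\<^sup>2 / 4)) \<partial>density lborel (\<lambda>x. ennreal (?p x)))
     = (\<integral>\<^sup>+ x. ennreal (?p x * exp (real n * (x - a)\<^sup>2 / 4)) \<partial>lborel)"
    using s by (subst nn_integral_density) (auto simp: ennreal_mult)
  also have "\<dots> = ennreal (sqrt 2) * (\<integral>\<^sup>+ x. ennreal (?q x) \<partial>lborel)"
    unfolding eq by (simp add: ennreal_mult nn_integral_cmult)
  also have "(\<integral>\<^sup>+ x. ennreal (?q x) \<partial>lborel) = ennreal 1"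
    using s by (subst nn_integral_eq_integral) auto
  also have "ennreal (sqrt 2) * ennreal 1 \<le> ennreal 2" 
    using sqrt2_less_2 by (simp del: ennreal_numeral)
  finally show ?thesis by simp
qed

text \<open>Integrating out the noise replaces n (x - a)^2 by its mean 1 in the pointwise bound,
  whence 26 = 16 + 10.\<close>

lemma coord_risk_le:
  assumes "prob_space \<mu>" and sets: "sets \<mu> = sets borel" and n: "0 < n"
    and m: "0 < m" "m \<le> measure \<mu> {\<theta>. \<bar>\<theta> - a\<bar> \<le> 1 / sqrt (real n)}"
  shows "coord_risk n \<mu> a \<le> ennreal ((26 + 8 * ln (1 / m)) / real n)"
proof -
  interpret prob_space \<mu> by fact
  have m1: "m \<le> 1" using m(2) prob_le_1 order_trans by blast
  then have l: "0 \<le> ln (1 / m)" using m by (simp add: ln_div)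
  have "coord_risk n \<mu> a \<le> (\<integral>\<^sup>+ x. ennreal ((16 + 8 * ln (1 / m)) / real n + 10 / real n * (real n * (x - a)\<^sup>2))
      \<partial>density lborel (\<lambda>x. ennreal (normal_density a (1 / sqrt (real n)) x)))"
    unfolding coord_risk_def
  proof (intro nn_integral_mono)
    show "(\<integral>\<^sup>+ \<theta>. ennreal ((\<theta> - a)\<^sup>2) \<partial>coord_posterior n \<mu> x)
       \<le> ennreal ((16 + 8 * ln (1 / m)) / real n + 10 / real n * (real n * (x - a)\<^sup>2))" for x
      using posterior_second_moment_le[OF assms, of x] by (simp add: add_divide_distrib)
  qed
  also have "\<dots> = ennreal ((16 + 8 * ln (1 / m)) / real n + 10 / real n)"
    using l n by (intro nn_integral_normal_square) auto
  also have "(16 + 8 * ln (1 / m)) / real n + 10 / real n = (26 + 8 * ln (1 / m)) / real n"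
    by (simp add: add_divide_distrib[symmetric])
  finally show ?thesis .
qed

text \<open>For a parameter below the noise level the likelihood ratio against 0 is integrated on the
  window on which the noise is at most T times its standard deviation; off the window the
  bound through the prior mass of the ball gains the factor exp (- T^2 / 8).\<close>

lemma coord_risk_small_parameter_le:
  assumes "prob_space \<mu>" and sets: "sets \<mu> = sets borel" and n: "0 < n"
    and m: "0 < m" "m \<le> measure \<mu> {\<theta>. \<bar>\<theta> - a\<bar> \<le> 1 / sqrt (real n)}"
    and sym: "distr \<mu> borel uminus = \<mu>"
    and c: "0 < c" "ennreal c \<le> (\<integral>\<^sup>+ \<theta>. ennreal (exp (- real n * \<theta>\<^sup>2 / 2)) \<partial>\<mu>)"
    and v: "0 \<le> v" "(\<integral>\<^sup>+ \<theta>. ennreal (\<theta>\<^sup>2) \<partial>\<mu>) \<le> ennreal v"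
    and T: "1 \<le> T" "\<bar>a\<bar> * T * sqrt (real n) \<le> 1"
  shows "coord_risk n \<mu> a \<le>
    ennreal (2 * a\<^sup>2 + 18 * T * v / c + 2 * exp (- T\<^sup>2 / 8) * (96 + 8 * ln (1 / m)) / real n)"
proof -
  interpret prob_space \<mu> by fact
  have m1: "m \<le> 1" using m(2) prob_le_1 order_trans by blast
  then have l: "0 \<le> ln (1 / m)" using m by (simp add: ln_div)
  have s: "0 < sqrt (real n)" using n by simp
  let ?N = "density lborel (\<lambda>x. ennreal (normal_density a (1 / sqrt (real n)) x))"
  interpret N: prob_space ?N by (rule prob_space_normal[OF n])
  let ?W = "{a - T / sqrt (real n) .. a + T / sqrt (real n)}"
  define E where "E = exp (- T\<^sup>2 / 8) * (96 + 8 * ln (1 / m)) / real n"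
  have E0: "0 \<le> E" using l by (simp add: E_def)
  let ?h = "\<lambda>x. 2 * v / c * exp (real n * x\<^sup>2 / 2)"
  have pt: "(\<integral>\<^sup>+ \<theta>. ennreal ((\<theta> - a)\<^sup>2) \<partial>coord_posterior n \<mu> x) \<le>
    (ennreal (2 * a\<^sup>2) + ennreal (?h x) * indicator ?W x) + ennreal E * ennreal (exp (real n * (x - a)\<^sup>2 / 4))" for x
  proof (cases "x \<in> ?W")
    case True
    have "(\<integral>\<^sup>+ \<theta>. ennreal ((\<theta> - a)\<^sup>2) \<partial>coord_posterior n \<mu> x) \<le> ennreal (2 * a\<^sup>2 + ?h x)"
      using posterior_second_moment_symmetric_le[OF assms(1) sets sym c v, where x=x and a=a] by simp
    also have "\<dots> = ennreal (2 * a\<^sup>2) + ennreal (?h x) * indicator ?W x"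
      using True c v by (simp add: ennreal_plus)
    also have "\<dots> \<le> \<dots> + ennreal E * ennreal (exp (real n * (x - a)\<^sup>2 / 4))" by simp
    finally show ?thesis .
  next
    case False
    define w where "w = real n * (x - a)\<^sup>2"
    have "T / sqrt (real n) \<le> \<bar>x - a\<bar>" using False by auto
    then have "T \<le> sqrt (real n) * \<bar>x - a\<bar>" using s by (simp add: field_simps)
    then have "T\<^sup>2 \<le> (sqrt (real n) * \<bar>x - a\<bar>)\<^sup>2" using T by (intro power_mono) auto
    then have Tw: "T\<^sup>2 \<le> w" by (simp add: w_def power_mult_distrib)
    \<comment> \<open>The linear term 10 w is absorbed into 80 exp (w / 8), whence 96 = 16 + 80. As
      T^2 \<le> w off the window, exp (w / 8) is at most exp (- T^2 / 8) exp (w / 4), and exp (w /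
      4) still has a finite expectation.\<close>
    have "w / 8 \<le> exp (w / 8)" using exp_ge_add_one_self[of "w / 8"] by linarith
    moreover have "1 \<le> exp (w / 8)" using Tw by (simp add: w_def)
    moreover from this have "(16 + 8 * ln (1 / m)) * 1 \<le> (16 + 8 * ln (1 / m)) * exp (w / 8)"
      using l by (intro mult_left_mono) auto
    ultimately have "16 + 8 * ln (1 / m) + 10 * w \<le> (16 + 8 * ln (1 / m)) * exp (w / 8) + 80 * exp (w / 8)"
      by simp
    also have "\<dots> = (96 + 8 * ln (1 / m)) * exp (w / 8)" by (simp add: algebra_simps)
    also have "\<dots> \<le> (96 + 8 * ln (1 / m)) * (exp (- T\<^sup>2 / 8) * exp (w / 4))"
      using l Tw by (intro mult_left_mono) (auto simp: mult_exp_exp)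
    finally have "(16 + 8 * ln (1 / m) + 10 * w) / real n
        \<le> (96 + 8 * ln (1 / m)) * (exp (- T\<^sup>2 / 8) * exp (w / 4)) / real n"
      by (rule divide_right_mono) simp
    also have "\<dots> = E * exp (w / 4)" by (simp add: E_def)
    finally have "(16 + 8 * ln (1 / m) + 10 * w) / real n \<le> E * exp (w / 4)" .
    then have "(\<integral>\<^sup>+ \<theta>. ennreal ((\<theta> - a)\<^sup>2) \<partial>coord_posterior n \<mu> x) \<le> ennreal (E * exp (w / 4))"
      using posterior_second_moment_le[OF assms(1) sets n m, of x] unfolding w_def
      by (meson ennreal_leI order_trans)
    then show ?thesis using E0 False by (simp add: w_def ennreal_mult add_increasing)
  qed
  have "coord_risk n \<mu> a \<le> (\<integral>\<^sup>+ x. (ennreal (2 * a\<^sup>2) + ennreal (?h x) * indicator ?W x) + ennreal E * ennreal (exp (real n * (x - a)\<^sup>2 / 4)) \<partial>?N)"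
    unfolding coord_risk_def by (intro nn_integral_mono pt)
  also have "\<dots> = (\<integral>\<^sup>+ x. ennreal (2 * a\<^sup>2) + ennreal (?h x) * indicator ?W x \<partial>?N) + (\<integral>\<^sup>+ x. ennreal E * ennreal (exp (real n * (x - a)\<^sup>2 / 4)) \<partial>?N)"
    by (rule nn_integral_add) auto
  also have "(\<integral>\<^sup>+ x. ennreal (2 * a\<^sup>2) + ennreal (?h x) * indicator ?W x \<partial>?N) = (\<integral>\<^sup>+ x. ennreal (2 * a\<^sup>2) \<partial>?N) + (\<integral>\<^sup>+ x. ennreal (?h x) * indicator ?W x \<partial>?N)"
    by (rule nn_integral_add) auto
  also have "(\<integral>\<^sup>+ x. ennreal E * ennreal (exp (real n * (x - a)\<^sup>2 / 4)) \<partial>?N) = ennreal E * (\<integral>\<^sup>+ x. ennreal (exp (real n * (x - a)\<^sup>2 / 4)) \<partial>?N)"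
    by (rule nn_integral_cmult) auto
  also have "(\<integral>\<^sup>+ x. ennreal (2 * a\<^sup>2) \<partial>?N) = ennreal (2 * a\<^sup>2)"
    using N.emeasure_space_1 by simp
  also have "(ennreal (2 * a\<^sup>2) + (\<integral>\<^sup>+ x. ennreal (?h x) * indicator ?W x \<partial>?N)) + ennreal E * (\<integral>\<^sup>+ x. ennreal (exp (real n * (x - a)\<^sup>2 / 4)) \<partial>?N)
      \<le> (ennreal (2 * a\<^sup>2) + ennreal (18 * T * v / c)) + ennreal E * 2"
  proof (intro add_mono mult_left_mono nn_integral_normal_exp_square n)
    have "(\<integral>\<^sup>+ x. ennreal (?h x) * indicator ?W x \<partial>?N)
      = (\<integral>\<^sup>+ x. ennreal (normal_density a (1 / sqrt (real n)) x) * (ennreal (?h x) * indicator ?W x) \<partial>lborel)"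
      by (subst nn_integral_density) auto
    also have "\<dots> \<le> (\<integral>\<^sup>+ x. ennreal (9 * v / c * sqrt (real n)) * indicator ?W x \<partial>lborel)"
    proof (intro nn_integral_mono)
      fix x
      \<comment> \<open>The quadratic terms in x cancel, leaving the exponent n a (x - a) + n a^2 /
        2. On the window the smallness of \<open>a\<close> bounds n a (x - a) and n a^2 by 1, so the
        exponential is at most exp 2 \<le> 9. The remaining integral is a constant times the window
        length 2 T / sqrt n, which gives the factor 18 T.\<close>
      have "normal_density a (1 / sqrt (real n)) x * ?h x \<le> 9 * v / c * sqrt (real n)" if x: "x \<in> ?W"
      proof -
        have "sqrt 4 \<le> sqrt (2 * pi)" using pi_gt3 by (intro real_sqrt_le_mono) linarith
        then have sp: "2 \<le> sqrt (2 * pi)" by simp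
        have ax: "\<bar>x - a\<bar> \<le> T / sqrt (real n)" using x by auto
        then have "\<bar>x - a\<bar> * sqrt (real n) \<le> T" using s by (simp add: field_simps)
        then have "\<bar>a\<bar> * sqrt (real n) * (\<bar>x - a\<bar> * sqrt (real n)) \<le> \<bar>a\<bar> * sqrt (real n) * T"
          by (intro mult_left_mono) auto
        moreover have "\<bar>a\<bar> * sqrt (real n) * (\<bar>x - a\<bar> * sqrt (real n)) = (sqrt (real n) * sqrt (real n)) * (\<bar>a\<bar> * \<bar>x - a\<bar>)"
          by (simp only: mult_ac)
        moreover have "sqrt (real n) * sqrt (real n) = real n" by simp
        moreover have "\<bar>a\<bar> * sqrt (real n) * T \<le> 1" using T(2) by (simp only: mult_ac)
        ultimately have "real n * (\<bar>a\<bar> * \<bar>x - a\<bar>) \<le> 1"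
          by (metis order_trans)
        moreover have "a * (x - a) \<le> \<bar>a\<bar> * \<bar>x - a\<bar>" by (metis abs_ge_self abs_mult)
        ultimately have 1: "real n * (a * (x - a)) \<le> 1"
          by (meson mult_left_mono of_nat_0_le_iff order_trans)
        have "\<bar>a\<bar> * sqrt (real n) * 1 \<le> \<bar>a\<bar> * sqrt (real n) * T" using T by (intro mult_left_mono) auto
        then have "\<bar>a\<bar> * sqrt (real n) \<le> 1" using T(2) by (simp add: mult_ac)
        then have "(\<bar>a\<bar> * sqrt (real n))\<^sup>2 \<le> 1" by (intro power_le_one) auto
        then have 2: "real n * a\<^sup>2 \<le> 1" by (simp add: power_mult_distrib mult_ac)
        have "exp (- (real n * (x - a)\<^sup>2 / 2)) * exp (real n * x\<^sup>2 / 2) = exp (real n * (a * (x - a)) + real n * a\<^sup>2 / 2)"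
          unfolding mult_exp_exp by (rule arg_cong[of _ _ exp]) (simp add: power2_eq_square field_simps)
        also have "\<dots> \<le> exp (1 + 1)" using 1 2 by simp
        also have "\<dots> \<le> 3 * 3" unfolding exp_add by (intro mult_mono exp_le) auto
        finally have e: "exp (- (real n * (x - a)\<^sup>2 / 2)) * exp (real n * x\<^sup>2 / 2) \<le> 9" by simp
        have "normal_density a (1 / sqrt (real n)) x * ?h x
          = (sqrt (real n) / sqrt (2 * pi)) * (2 * v / c) * (exp (- (real n * (x - a)\<^sup>2 / 2)) * exp (real n * x\<^sup>2 / 2))"
          using n by (simp add: normal_density_def power_divide real_sqrt_divide)
        also have "\<dots> \<le> (sqrt (real n) / 2) * (2 * v / c) * 9"
          using e sp v c s by (intro mult_mono divide_left_mono) auto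
        finally show ?thesis by (simp add: mult_ac)
      qed
      then show "ennreal (normal_density a (1 / sqrt (real n)) x) * (ennreal (?h x) * indicator ?W x)
        \<le> ennreal (9 * v / c * sqrt (real n)) * indicator ?W x"
        using v c by (auto split: split_indicator simp: ennreal_mult[symmetric] intro!: ennreal_leI)
    qed
    also have "\<dots> = ennreal (9 * v / c * sqrt (real n)) * ennreal (2 * T / sqrt (real n))"
      using T s by (subst nn_integral_cmult_indicator) auto
    also have "\<dots> = ennreal (18 * T * v / c)"
      using T s v c by (simp add: ennreal_mult[symmetric])
    finally show "(\<integral>\<^sup>+ x. ennreal (?h x) * indicator ?W x \<partial>?N) \<le> ennreal (18 * T * v / c)" .
  qed auto
  also have "ennreal E * 2 = ennreal (2 * E)" using E0 by (simp add: ennreal_mult mult.commute)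
  also have "ennreal (2 * a\<^sup>2) + ennreal (18 * T * v / c) + ennreal (2 * E) = ennreal (2 * a\<^sup>2 + 18 * T * v / c + 2 * E)"
    using E0 v c T by (simp add: ennreal_plus)
  finally show ?thesis by (simp add: E_def mult_ac)
qed

section \<open>From coordinate risks to posterior mass outside a ball\<close>

lemma nn_integral_PiM_component:
  assumes "\<And>i. i \<in> I \<Longrightarrow> prob_space (M i)" and i: "i \<in> I" and g: "g \<in> borel_measurable (M i)"
  shows "(\<integral>\<^sup>+ \<omega>. g (\<omega> i) \<partial>Pi\<^sub>M I M) = (\<integral>\<^sup>+ x. g x \<partial>M i)"
proof -
  have "(\<integral>\<^sup>+ x. g x \<partial>M i) = (\<integral>\<^sup>+ x. g x \<partial>distr (Pi\<^sub>M I M) (M i) (\<lambda>\<omega>. \<omega> i))"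
    using distr_PiM_component[where I=I and M=M and i=i, OF assms(1) i] by metis
  also have "\<dots> = (\<integral>\<^sup>+ \<omega>. g (\<omega> i) \<partial>Pi\<^sub>M I M)"
    using i g by (intro nn_integral_distr[of "\<lambda>\<omega>. \<omega> i"] measurable_component_singleton) auto
  finally show ?thesis by simp
qed

text \<open>The pointwise inequality behind Markov's. It also covers sequences that are not square
  summable: their norm is infinite, and their series of squares in \<open>ennreal\<close> is
  \<open>top\<close>.\<close>

lemma l2_norm_markov:
  assumes r: "0 < r" and f: "ereal r < l2_norm f"
  shows "ennreal (r\<^sup>2) \<le> (\<Sum>j. ennreal ((f (Suc j))\<^sup>2))"
proof (cases "summable (\<lambda>j. (f (Suc j))\<^sup>2)")
  case True
  then have "r < sqrt (\<Sum>j. (f (Suc j))\<^sup>2)" using f by (simp add: l2_norm_def)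
  then have "r\<^sup>2 \<le> (sqrt (\<Sum>j. (f (Suc j))\<^sup>2))\<^sup>2" using r by (intro power_mono) auto
  also have "\<dots> = (\<Sum>j. (f (Suc j))\<^sup>2)" using True by (simp add: suminf_nonneg)
  finally show ?thesis using True by (simp add: suminf_ennreal2 ennreal_leI)
next
  case False
  have "(\<Sum>j. ennreal ((f (Suc j))\<^sup>2)) = top"
    by (rule ccontr, rule notE[OF False], rule summable_suminf_not_top) simp
  then show ?thesis by (simp only: top_greatest)
qed

text \<open>Markov's inequality under the posterior, followed by interchanging the series with the
  posterior integral and then with the integral over the data. Under both product measures each term
  depends on a single coordinate, so only marginals remain.\<close>

lemma expected_posterior_mass_outside_le:
  assumes p: "\<And>k. 1 \<le> k \<Longrightarrow> prob_space (\<pi> k)"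
    and sets: "\<And>k. 1 \<le> k \<Longrightarrow> sets (\<pi> k) = sets borel"
    and n: "0 < n" and r: "0 < r"
  shows "ennreal (expected_posterior_mass_outside n \<pi> f0 r)
    \<le> (\<Sum>j. coord_risk n (\<pi> (Suc j)) (f0 (Suc j))) / ennreal (r\<^sup>2)"
proof -
  let ?M = "(\<Pi>\<^sub>M k\<in>{1..}. borel) :: (nat \<Rightarrow> real) measure"
  let ?A = "{f \<in> space ?M. ereal r < l2_norm (\<lambda>k. f k - f0 k)}"
  define G where "G = (\<lambda>j x. \<integral>\<^sup>+ \<theta>. ennreal ((\<theta> - f0 j)\<^sup>2) \<partial>coord_posterior n (\<pi> j) x)"
  have sp: "space (posterior n \<pi> X) = space ?M" for X
    unfolding posterior_def space_PiM
    by (rule PiE_cong) (simp add: coord_posterior_def sets_eq_imp_space_eq[OF sets])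
  have sets_post: "sets (posterior n \<pi> X) = sets ?M" for X
    unfolding posterior_def by (rule sets_PiM_cong) (auto simp: sets)
  have sm: "sets (sequence_model n f0) = sets ?M"
    unfolding sequence_model_def by (rule sets_PiM_cong) auto
  have A: "?A \<in> sets ?M" using l2_norm_measurable[of f0, measurable] by measurable
  have pp: "prob_space (coord_posterior n (\<pi> k) x)" if "1 \<le> k" for k x
    using that by (intro prob_space_coord_posterior p sets)
  have comp: "(\<lambda>f. f (Suc j)) \<in> ?M \<rightarrow>\<^sub>M borel" for j
    by (intro measurable_component_singleton) auto
  have G_meas: "G (Suc j) \<in> borel_measurable borel" for j
    unfolding G_def
    by (rule measurable_compose[OF measurable_prob_algebraD[OF coord_posterior_measurable] nn_integral_measurable_subprob_algebra])
       (auto intro!: p sets)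
  have pm: "prob_space (posterior n \<pi> X)" for X
    unfolding posterior_def using pp by (intro prob_space_PiM) auto
  have bound: "ennreal (\<P>(f in posterior n \<pi> X. ereal r < l2_norm (\<lambda>k. f k - f0 k)))
      \<le> (\<Sum>j. G (Suc j) (X (Suc j))) / ennreal (r\<^sup>2)" for X
  proof -
    interpret P: prob_space "posterior n \<pi> X" by (rule pm)
    have [measurable]: "(\<lambda>f. f (Suc j)) \<in> posterior n \<pi> X \<rightarrow>\<^sub>M borel" for j
      by (subst measurable_cong_sets[OF sets_post refl]) (rule comp)
    have component: "(\<integral>\<^sup>+ f. ennreal ((f (Suc j) - f0 (Suc j))\<^sup>2) \<partial>posterior n \<pi> X) = G (Suc j) (X (Suc j))" for j
    proof -
      have "sets (coord_posterior n (\<pi> (Suc j)) (X (Suc j))) = sets borel"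
        by (simp add: sets)
      then have g: "(\<lambda>\<theta>. ennreal ((\<theta> - f0 (Suc j))\<^sup>2)) \<in> borel_measurable (coord_posterior n (\<pi> (Suc j)) (X (Suc j)))"
        by (subst measurable_cong_sets[OF _ refl]) auto
      show ?thesis
        unfolding posterior_def G_def 
        by (rule nn_integral_PiM_component[where I="{1..}" and i="Suc j" and
              M="\<lambda>k. coord_posterior n (\<pi> k) (X k)", OF _ _ g]) (auto simp: pp)
    qed
    have "ennreal (\<P>(f in posterior n \<pi> X. ereal r < l2_norm (\<lambda>k. f k - f0 k))) = emeasure (posterior n \<pi> X) ?A"
      by (simp add: sp P.emeasure_eq_measure)
    also have "\<dots> = (\<integral>\<^sup>+ f. indicator ?A f \<partial>posterior n \<pi> X)"
      using A by (simp add: sets_post)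
    also have "\<dots> \<le> (\<integral>\<^sup>+ f. (\<Sum>j. ennreal ((f (Suc j) - f0 (Suc j))\<^sup>2)) / ennreal (r\<^sup>2) \<partial>posterior n \<pi> X)"
    proof (intro nn_integral_mono)
      fix f
      show "indicator ?A f \<le> (\<Sum>j. ennreal ((f (Suc j) - f0 (Suc j))\<^sup>2)) / ennreal (r\<^sup>2)"
      proof (cases "f \<in> ?A")
        case True
        then have "ereal r < l2_norm (\<lambda>k. f k - f0 k)" by simp
        note divide_right_mono_ennreal[OF l2_norm_markov[OF r this], of "ennreal (r\<^sup>2)"]
        moreover have "ennreal (r\<^sup>2) / ennreal (r\<^sup>2) = 1" using r by (simp add: divide_ennreal)
        ultimately show ?thesis using True by simp
      qed simp
    qed
    also have "\<dots> = (\<integral>\<^sup>+ f. (\<Sum>j. ennreal ((f (Suc j) - f0 (Suc j))\<^sup>2)) \<partial>posterior n \<pi> X) / ennreal (r\<^sup>2)"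
      by (rule nn_integral_divide) measurable
    also have "(\<integral>\<^sup>+ f. (\<Sum>j. ennreal ((f (Suc j) - f0 (Suc j))\<^sup>2)) \<partial>posterior n \<pi> X)
      = (\<Sum>j. (\<integral>\<^sup>+ f. ennreal ((f (Suc j) - f0 (Suc j))\<^sup>2) \<partial>posterior n \<pi> X))"
      by (rule nn_integral_suminf) measurable
    also have "\<dots> = (\<Sum>j. G (Suc j) (X (Suc j)))"
      unfolding component ..
    finally show ?thesis .
  qed
  have comp_m: "(\<lambda>X. X (Suc j)) \<in> sequence_model n f0 \<rightarrow>\<^sub>M borel" for j
    by (subst measurable_cong_sets[OF sm refl]) (rule comp)
  note [measurable] = measurable_compose[OF comp_m G_meas]
  have component: "(\<integral>\<^sup>+ X. G (Suc j) (X (Suc j)) \<partial>sequence_model n f0) = coord_risk n (\<pi> (Suc j)) (f0 (Suc j))" for j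
  proof -
    have g: "G (Suc j) \<in> borel_measurable (density lborel (\<lambda>x. ennreal (normal_density (f0 (Suc j)) (1 / sqrt (real n)) x)))"
      using G_meas[of j] by simp
    have "(\<integral>\<^sup>+ X. G (Suc j) (X (Suc j)) \<partial>sequence_model n f0)
      = (\<integral>\<^sup>+ x. G (Suc j) x \<partial>density lborel (\<lambda>x. ennreal (normal_density (f0 (Suc j)) (1 / sqrt (real n)) x)))"
      unfolding sequence_model_def
      by (rule nn_integral_PiM_component[where I="{1..}" and i="Suc j" and
            M="\<lambda>k. density lborel (\<lambda>x. ennreal (normal_density (f0 k) (1 / sqrt (real n)) x))", OF _ _ g])
         (auto simp: prob_space_normal[OF n])
    then show ?thesis by (simp add: coord_risk_def G_def)
  qed
  have "ennreal (expected_posterior_mass_outside n \<pi> f0 r)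
     \<le> (\<integral>\<^sup>+ X. ennreal (\<P>(f in posterior n \<pi> X. ereal r < l2_norm (\<lambda>k. f k - f0 k))) \<partial>sequence_model n f0)"
  proof -
    let ?g = "\<lambda>X. \<P>(f in posterior n \<pi> X. ereal r < l2_norm (\<lambda>k. f k - f0 k))"
    have "?g \<in> borel_measurable (sequence_model n f0)"
      by (rule posterior_mass_measurable[OF p sets])
    \<comment> \<open>\<open>enn2real\<close> sends \<open>top\<close> to 0, so going back to
      \<open>ennreal\<close> can only decrease the value, which is the direction wanted.\<close>
    then have "expected_posterior_mass_outside n \<pi> f0 r = enn2real (\<integral>\<^sup>+ X. ennreal (?g X) \<partial>sequence_model n f0)"
      unfolding expected_posterior_mass_outside_def by (rule integral_eq_nn_integral) simp
    then show ?thesis by (simp add: ennreal_enn2real_if)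
  qed
  also have "\<dots> \<le> (\<integral>\<^sup>+ X. (\<Sum>j. G (Suc j) (X (Suc j))) / ennreal (r\<^sup>2) \<partial>sequence_model n f0)"
    by (intro nn_integral_mono bound)
  also have "\<dots> = (\<integral>\<^sup>+ X. (\<Sum>j. G (Suc j) (X (Suc j))) \<partial>sequence_model n f0) / ennreal (r\<^sup>2)"
    by (rule nn_integral_divide) measurable
  also have "(\<integral>\<^sup>+ X. (\<Sum>j. G (Suc j) (X (Suc j))) \<partial>sequence_model n f0)
    = (\<Sum>j. \<integral>\<^sup>+ X. G (Suc j) (X (Suc j)) \<partial>sequence_model n f0)"
    by (rule nn_integral_suminf) measurable
  also have "\<dots> = (\<Sum>j. coord_risk n (\<pi> (Suc j)) (f0 (Suc j)))"
    unfolding component ..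
  finally show ?thesis .
qed

lemma coord_risk_return_0:
  assumes "0 < n"
  shows "coord_risk n (return borel 0) a = ennreal (a\<^sup>2)"
proof -
  interpret prob_space "density lborel (\<lambda>x. ennreal (normal_density a (1 / sqrt (real n)) x))"
    by (rule prob_space_normal[OF assms])
  show ?thesis
    using emeasure_space_1 by (simp add: coord_risk_def coord_posterior_return_0 nn_integral_return)
qed

section \<open>Prior mass and moments of a rescaled density\<close>

lemma nn_integral_scaled_law:
  assumes [measurable]: "h \<in> borel_measurable borel" "g \<in> borel_measurable borel"
  shows "(\<integral>\<^sup>+ \<theta>. g \<theta> \<partial>scaled_law h s) = (\<integral>\<^sup>+ z. ennreal (h z) * g (s * z) \<partial>lborel)"
proof -
  have "(\<integral>\<^sup>+ \<theta>. g \<theta> \<partial>scaled_law h s) = (\<integral>\<^sup>+ z. g (s * z) \<partial>density lborel (\<lambda>z. ennreal (h z)))"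
    unfolding scaled_law_def by (rule nn_integral_distr) auto
  also have "\<dots> = (\<integral>\<^sup>+ z. ennreal (h z) * g (s * z) \<partial>lborel)"
    by (rule nn_integral_density) auto
  finally show ?thesis .
qed

lemma scaled_law_symmetric:
  assumes h[measurable]: "h \<in> borel_measurable borel" and sym: "\<And>x. h (- x) = h x"
  shows "distr (scaled_law h s) borel uminus = scaled_law h s"
proof (rule measure_eqI)
  fix A assume "A \<in> sets (distr (scaled_law h s) borel uminus)"
  then have A[measurable]: "A \<in> sets borel" by simp
  have "emeasure (distr (scaled_law h s) borel uminus) A
      = (\<integral>\<^sup>+ \<theta>. indicator A \<theta> \<partial>distr (scaled_law h s) borel uminus)" by simp
  also have "\<dots> = (\<integral>\<^sup>+ \<theta>. indicator A (- \<theta>) \<partial>scaled_law h s)"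
    by (rule nn_integral_distr) auto
  also have "\<dots> = (\<integral>\<^sup>+ z. ennreal (h z) * indicator A (- (s * z)) \<partial>lborel)"
    by (rule nn_integral_scaled_law) auto
  also have "\<dots> = (\<integral>\<^sup>+ z. ennreal (h z) * indicator A (s * z) \<partial>lborel)"
    by (subst nn_integral_real_affine[where c="-1" and t=0]) (auto simp: sym)
  also have "\<dots> = (\<integral>\<^sup>+ \<theta>. indicator A \<theta> \<partial>scaled_law h s)"
    by (rule nn_integral_scaled_law[symmetric]) auto
  also have "\<dots> = emeasure (scaled_law h s) A" by simp
  finally show "emeasure (distr (scaled_law h s) borel uminus) A = emeasure (scaled_law h s) A" .
qed simp

locale symmetric_decreasing_density =
  fixes h :: "real \<Rightarrow> real"
  assumes h_meas[measurable]: "h \<in> borel_measurable borel"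
    and h_density: "(\<integral>\<^sup>+ x. ennreal (h x) \<partial>lborel) = 1"
    and h_sym: "\<And>x. h (- x) = h x"
    and h_pos: "\<And>x. 0 < h x"
    and h_decreasing: "\<And>x y. 0 \<le> x \<Longrightarrow> x \<le> y \<Longrightarrow> h y \<le> h x"
    and h_second_moment: "integrable lborel (\<lambda>x. x\<^sup>2 * h x)"
begin

definition m2 :: real where "m2 = (\<integral>x. x\<^sup>2 * h x \<partial>lborel)"

lemma m2_nonneg: "0 \<le> m2"
  unfolding m2_def by (intro integral_nonneg_AE) (auto intro!: mult_nonneg_nonneg less_imp_le[OF h_pos])

lemma h_abs_decreasing: "\<bar>x\<bar> \<le> y \<Longrightarrow> h y \<le> h x"
  using h_decreasing[of "\<bar>x\<bar>" y] h_sym[of x] by (auto simp: abs_if split: if_splits)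

lemma scaled_law_second_moment:
  "(\<integral>\<^sup>+ \<theta>. ennreal (\<theta>\<^sup>2) \<partial>scaled_law h s) = ennreal (s\<^sup>2 * m2)"
proof -
  have "(\<integral>\<^sup>+ \<theta>. ennreal (\<theta>\<^sup>2) \<partial>scaled_law h s) = (\<integral>\<^sup>+ z. ennreal (h z) * ennreal ((s * z)\<^sup>2) \<partial>lborel)"
    by (rule nn_integral_scaled_law) auto
  also have "\<dots> = (\<integral>\<^sup>+ z. ennreal (s\<^sup>2) * ennreal (z\<^sup>2 * h z) \<partial>lborel)"
    using h_pos by (intro nn_integral_cong) (simp add: ennreal_mult[symmetric] less_imp_le power_mult_distrib mult_ac)
  also have "\<dots> = ennreal (s\<^sup>2) * (\<integral>\<^sup>+ z. ennreal (z\<^sup>2 * h z) \<partial>lborel)"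
    by (rule nn_integral_cmult) auto
  also have "(\<integral>\<^sup>+ z. ennreal (z\<^sup>2 * h z) \<partial>lborel) = ennreal m2"
    unfolding m2_def using h_second_moment h_pos by (intro nn_integral_eq_integral) (auto simp: less_imp_le)
  finally show ?thesis using m2_nonneg by (simp add: ennreal_mult)
qed

text \<open>Only the unscaled variable in {0..1} is kept, where the density is at least
  \<open>h 1\<close> and the exponent at most B / 2. The bound depends on n and s through B
  alone.\<close>

lemma scaled_law_gaussian_mean_ge:
  assumes B: "real n * s\<^sup>2 \<le> B"
  shows "ennreal (h 1 * exp (- B / 2)) \<le> (\<integral>\<^sup>+ \<theta>. ennreal (exp (- real n * \<theta>\<^sup>2 / 2)) \<partial>scaled_law h s)"
proof -
  have "ennreal (h 1 * exp (- B / 2)) = (\<integral>\<^sup>+ z. ennreal (h 1 * exp (- B / 2)) * indicator {0..1::real} z \<partial>lborel)"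
    by (subst nn_integral_cmult_indicator) auto
  also have "\<dots> \<le> (\<integral>\<^sup>+ z. ennreal (h z) * ennreal (exp (- real n * (s * z)\<^sup>2 / 2)) \<partial>lborel)"
  proof (intro nn_integral_mono)
    fix z :: real
    have "h 1 * exp (- B / 2) \<le> h z * exp (- real n * (s * z)\<^sup>2 / 2)" if z: "z \<in> {0..1::real}"
    proof (intro mult_mono)
      have "z\<^sup>2 \<le> 1" using z by (intro power_le_one) auto
      then have "(real n * s\<^sup>2) * z\<^sup>2 \<le> real n * s\<^sup>2" by (intro mult_left_le) auto
      then show "exp (- B / 2) \<le> exp (- real n * (s * z)\<^sup>2 / 2)"
        using B by (simp add: power_mult_distrib mult_ac)
    qed (use z h_decreasing[of z 1] h_pos in \<open>auto simp: less_imp_le\<close>)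
    then show "ennreal (h 1 * exp (- B / 2)) * indicator {0..1::real} z
        \<le> ennreal (h z) * ennreal (exp (- real n * (s * z)\<^sup>2 / 2))"
      using h_pos[of z] by (auto split: split_indicator simp: ennreal_mult[symmetric] less_imp_le intro!: ennreal_leI)
  qed
  also have "\<dots> = (\<integral>\<^sup>+ \<theta>. ennreal (exp (- real n * \<theta>\<^sup>2 / 2)) \<partial>scaled_law h s)"
    by (rule nn_integral_scaled_law[symmetric]) auto
  finally show ?thesis .
qed

text \<open>In the unscaled variable, the one-sided interval of length 1 / sqrt n starting at a / s
  is mapped into the ball because s \<le> 1, and on it the density is at least its value at
  (\<bar>a\<bar> + 1) / s. The preimage of the ball is longer by the factor 2 / s, but only the
  logarithm of the bound matters.\<close>

lemma scaled_law_ball_ge: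
  assumes s: "0 < s" "s \<le> 1" and n: "0 < n"
  shows "1 / sqrt (real n) * h ((\<bar>a\<bar> + 1) / s)
    \<le> measure (scaled_law h s) {\<theta>. \<bar>\<theta> - a\<bar> \<le> 1 / sqrt (real n)}"
proof -
  interpret prob_space "scaled_law h s"
    by (rule prob_space_scaled_law) (auto simp: h_density)
  let ?S = "{\<theta>. \<bar>\<theta> - a\<bar> \<le> 1 / sqrt (real n)}"
  let ?I = "{a / s .. a / s + 1 / sqrt (real n)}"
  define H where "H = h ((\<bar>a\<bar> + 1) / s)"
  have H0: "0 \<le> H" by (simp add: H_def h_pos less_imp_le)
  have "ennreal (1 / sqrt (real n) * H) = ennreal H * ennreal (1 / sqrt (real n))"
    using H0 by (simp add: ennreal_mult[symmetric] mult.commute)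
  also have "\<dots> = (\<integral>\<^sup>+ z. ennreal H * indicator ?I z \<partial>lborel)"
    by (subst nn_integral_cmult_indicator) auto
  also have "\<dots> \<le> (\<integral>\<^sup>+ z. ennreal (h z) * indicator ?S (s * z) \<partial>lborel)"
  proof (intro nn_integral_mono)
    fix z
    have "H \<le> h z \<and> s * z \<in> ?S" if z: "z \<in> ?I"
    proof
      have d: "0 \<le> z - a / s" "z - a / s \<le> 1 / sqrt (real n)" using z by auto
      have n1: "1 / sqrt (real n) \<le> 1" using n by simp
      have "\<bar>z\<bar> \<le> \<bar>a / s\<bar> + 1" using d n1 by linarith
      also have "\<dots> = (\<bar>a\<bar> + s) / s" using s by (simp add: field_simps)
      also have "\<dots> \<le> (\<bar>a\<bar> + 1) / s" using s by (intro divide_right_mono) auto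
      finally show "H \<le> h z" unfolding H_def by (rule h_abs_decreasing)
      have eq: "s * z - a = s * (z - a / s)" using s by (simp add: field_simps)
      have "s * (z - a / s) \<le> 1 * (z - a / s)" using s d by (intro mult_right_mono) auto
      then have "s * (z - a / s) \<le> 1 / sqrt (real n)" using d by simp
      moreover have "0 \<le> s * (z - a / s)" using s d by simp
      ultimately show "s * z \<in> ?S" unfolding mem_Collect_eq eq by simp
    qed
    then show "ennreal H * indicator ?I z \<le> ennreal (h z) * indicator ?S (s * z)"
      by (auto split: split_indicator intro!: ennreal_leI)
  qed
  also have "\<dots> = (\<integral>\<^sup>+ \<theta>. indicator ?S \<theta> \<partial>scaled_law h s)"
    by (rule nn_integral_scaled_law[symmetric]) auto
  also have "\<dots> = ennreal (measure (scaled_law h s) ?S)"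
    by (simp add: emeasure_eq_measure)
  finally show ?thesis by (simp add: H_def)
qed

end

section \<open>Risk bounds that are uniform in sample size and frequency\<close>

text \<open>The common properties of both scale sequences. \<open>\<sigma>_decay\<close> says that
  the prior is at least as smooth as the Sobolev ball; this is where \<alpha> \<ge> \<beta> enters.
  \<open>ln_\<sigma>\<close> forbids scales so small that a tail event of the prior would have more
  than polylogarithmic cost; the square accommodates exp (- (ln k)^2).\<close>

locale heavy_tailed_prior = symmetric_decreasing_density +
  fixes c1 \<kappa> \<beta> A L :: real and \<sigma> f0 :: "nat \<Rightarrow> real"
  assumes c1: "0 < c1" and \<kappa>: "0 \<le> \<kappa>" and \<beta>: "0 < \<beta>" and A: "0 \<le> A" and L: "0 \<le> L"
    and h_tail: "\<And>x. 0 \<le> x \<Longrightarrow> ln (1 / h x) \<le> c1 * (1 + ln (1 + x) powr (1 + \<kappa>))"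
    and \<sigma>_pos: "\<And>k. 1 \<le> k \<Longrightarrow> 0 < \<sigma> k"
    and \<sigma>_le_1: "\<And>k. 1 \<le> k \<Longrightarrow> \<sigma> k \<le> 1"
    and \<sigma>_decay: "\<And>k. 1 \<le> k \<Longrightarrow> \<sigma> k \<le> A * real k powr (- 1 / 2 - \<beta>)"
    and ln_\<sigma>: "\<And>k. 1 \<le> k \<Longrightarrow> ln (1 / \<sigma> k) \<le> A * (1 + ln (real k))\<^sup>2"
    and f0: "f0 \<in> sobolev_ball \<beta> L"
begin

lemma f0_le:
  assumes k: "1 \<le> k"
  shows "\<bar>f0 k\<bar> \<le> L"
proof -
  let ?g = "\<lambda>j. real (Suc j) powr (2 * \<beta>) * (f0 (Suc j))\<^sup>2"
  have g: "summable ?g" "(\<Sum>j. ?g j) \<le> L\<^sup>2" using f0 by (auto simp: sobolev_ball_def)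
  obtain j where j: "k = Suc j" using k by (cases k) auto
  have "1 \<le> real k powr (2 * \<beta>)" using k \<beta> by (intro ge_one_powr_ge_zero) auto
  then have "(f0 k)\<^sup>2 \<le> ?g j" using mult_right_mono[of 1 "real k powr (2 * \<beta>)" "(f0 k)\<^sup>2"] by (simp add: j)
  also have "\<dots> = sum ?g {j}" by simp
  also have "\<dots> \<le> (\<Sum>j. ?g j)" by (rule sum_le_suminf[OF g(1)]) auto
  also have "\<dots> \<le> L\<^sup>2" by (rule g(2))
  finally show ?thesis using L by (metis abs_le_square_iff abs_of_nonneg)
qed

text \<open>Not the mass itself but the explicit lower bound from \<open>scaled_law_ball_ge\<close>,
  whose logarithm can be estimated by the tail condition on \<open>h\<close>.\<close>

definition ball_mass :: "nat \<Rightarrow> nat \<Rightarrow> real" where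
  "ball_mass n k = 1 / sqrt (real n) * h ((\<bar>f0 k\<bar> + 1) / \<sigma> k)"

text \<open>The argument of \<open>h\<close> is of order 1 / \<sigma> k, so its logarithm is at most
  a constant times l^2 with l = 1 + ln n + ln k. The tail condition raises this to the power 1 +
  \<kappa>; the factor 1 / sqrt n adds only a multiple of ln n.\<close>

lemma ln_ball_mass_le:
  "\<exists>C q. 0 < C \<and> (\<forall>n k. 1 \<le> n \<longrightarrow> 1 \<le> k \<longrightarrow>
    ln (1 / ball_mass n k) \<le> C * (1 + ln (real n) + ln (real k)) ^ q)"
proof -
  \<comment> \<open>Rounding the exponent up gives natural powers of l.\<close>
  define N where "N = nat \<lceil>1 + \<kappa>\<rceil>"
  have N: "1 + \<kappa> \<le> real N" unfolding N_def by linarith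
  then have N1: "1 \<le> N" using \<kappa> by linarith
  define D where "D = ln (L + 2) + A"
  have D: "0 \<le> D" unfolding D_def using L A by (intro add_nonneg_nonneg) auto
  define C where "C = 1 + c1 + c1 * D powr (1 + \<kappa>)"
  have "ln (1 / ball_mass n k) \<le> C * (1 + ln (real n) + ln (real k)) ^ (2 * N)"
    if n: "1 \<le> n" and k: "1 \<le> k" for n k
  proof -
    define l where "l = 1 + ln (real n) + ln (real k)"
    define y where "y = (\<bar>f0 k\<bar> + 1) / \<sigma> k"
    have lnk: "0 \<le> ln (real n)" "0 \<le> ln (real k)" using n k by auto
    have l1: "1 \<le> l" using lnk by (simp add: l_def)
    note s = \<sigma>_pos[OF k] \<sigma>_le_1[OF k]
    have y0: "0 \<le> y" using s by (simp add: y_def)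
    have "1 \<le> 1 / \<sigma> k" "y \<le> (L + 1) / \<sigma> k"
      using s f0_le[OF k] by (auto simp: y_def intro!: divide_right_mono)
    then have "1 + y \<le> (L + 2) / \<sigma> k" by (simp add: add_divide_distrib)
    then have "ln (1 + y) \<le> ln ((L + 2) / \<sigma> k)" using y0 L s by (subst ln_le_cancel_iff) auto
    also have "\<dots> = ln (L + 2) + ln (1 / \<sigma> k)" using L s by (simp add: ln_div)
    also have "\<dots> \<le> ln (L + 2) * l\<^sup>2 + A * l\<^sup>2"
    proof (rule add_mono)
      show "ln (L + 2) \<le> ln (L + 2) * l\<^sup>2" 
        using l1 L by (simp add: mult_le_cancel_left1 one_le_power)
      have "A * (1 + ln (real k))\<^sup>2 \<le> A * l\<^sup>2"
        using A lnk by (intro mult_left_mono power_mono) (auto simp: l_def)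
      then show "ln (1 / \<sigma> k) \<le> A * l\<^sup>2" using ln_\<sigma>[OF k] by linarith
    qed
    finally have "ln (1 + y) \<le> D * l\<^sup>2" by (simp add: D_def algebra_simps)
    then have "ln (1 + y) powr (1 + \<kappa>) \<le> (D * l\<^sup>2) powr (1 + \<kappa>)"
      using y0 \<kappa> by (intro powr_mono2) auto
    also have "\<dots> = D powr (1 + \<kappa>) * (l\<^sup>2) powr (1 + \<kappa>)" by (rule powr_mult)
    also have "(l\<^sup>2) powr (1 + \<kappa>) \<le> (l\<^sup>2) powr real N"
      using N l1 by (intro powr_mono) (auto simp: one_le_power)
    also have "(l\<^sup>2) powr real N = l ^ (2 * N)" using l1 by (simp add: powr_realpow power_mult)
    finally have P: "ln (1 + y) powr (1 + \<kappa>) \<le> D powr (1 + \<kappa>) * l ^ (2 * N)"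
      by (simp add: mult_left_mono)
    have lq: "l \<le> l ^ (2 * N)" "1 \<le> l ^ (2 * N)"
      using l1 N1 power_increasing[of 1 "2 * N" l] by (auto simp: one_le_power)
    have "ln (1 / ball_mass n k) = ln (real n) / 2 + ln (1 / h y)"
      using n h_pos[of y] by (simp add: ball_mass_def y_def[symmetric] ln_div ln_mult ln_sqrt)
    also have "\<dots> \<le> l + c1 * (1 + ln (1 + y) powr (1 + \<kappa>))"
      using h_tail[OF y0] lnk by (simp add: l_def)
    also have "\<dots> \<le> l ^ (2 * N) + c1 * (l ^ (2 * N) + D powr (1 + \<kappa>) * l ^ (2 * N))"
      using c1 lq P by (intro add_mono mult_left_mono) auto
    finally show ?thesis by (simp add: C_def l_def algebra_simps)
  qed
  moreover have "0 < C" using c1 by (simp add: C_def add_pos_nonneg)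
  ultimately show ?thesis by blast
qed

text \<open>The second bound, needed beyond the cutoff, comes from a dichotomy. If \<bar>f0 k\<bar>
  T sqrt n \<le> 1, symmetry applies; otherwise 1/n is at most (f0 k)^2 T^2 and the first bound
  already suffices. Either way T costs one more logarithm, hence the exponent \<open>Suc q\<close>
  in the proof.\<close>

lemma coord_risk_series_prior:
  "\<exists>C q. 1 \<le> C \<and> 1 \<le> q \<and> (\<forall>n k. 1 \<le> n \<longrightarrow> 1 \<le> k \<longrightarrow>
    coord_risk n (scaled_law h (\<sigma> k)) (f0 k)
      \<le> ennreal (C * (1 + ln (real n) + ln (real k)) ^ q / real n) \<and>
    (real n \<le> real k powr (2 * \<beta> + 1) \<longrightarrow>
      coord_risk n (scaled_law h (\<sigma> k)) (f0 k)
      \<le> ennreal (C * (1 + ln (real n) + ln (real k)) ^ q * ((f0 k)\<^sup>2 + real k powr (- 1 - 2 * \<beta>)))))"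
proof -
  obtain C q where C: "0 < C" and mass: "\<And>n k. 1 \<le> n \<Longrightarrow> 1 \<le> k \<Longrightarrow>
    ln (1 / ball_mass n k) \<le> C * (1 + ln (real n) + ln (real k)) ^ q"
    using ln_ball_mass_le by blast
  define c where "c = h 1 * exp (- A\<^sup>2 / 2)"
  have c: "0 < c" by (simp add: c_def h_pos)
  \<comment> \<open>Chosen so that T^2 = b * l gives exp (- T^2 / 8) = exp (- (1 + 2 * \<beta>) * l)
    \<le> k powr (- 1 - 2 * \<beta>).\<close>
  define b where "b = 8 * (1 + 2 * \<beta>)"
  have b: "8 \<le> b" using \<beta> by (simp add: b_def)
  define C1 where "C1 = 26 + 8 * C"
  define C2 where "C2 = 18 * b * A\<^sup>2 * m2 / c"
  define C3 where "C3 = 2 * (96 + 8 * C)"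
  define C4 where "C4 = C1 + 2 + C2 + C3 + C1 * b"
  have Cn: "0 \<le> C1" "0 \<le> C2" "0 \<le> C3" "0 \<le> C1 * b"
    using C b c m2_nonneg by (auto simp: C1_def C2_def C3_def)
  have *: "coord_risk n (scaled_law h (\<sigma> k)) (f0 k) \<le> ennreal (C4 * l ^ Suc q / real n) \<and>
    (real n \<le> real k powr (2 * \<beta> + 1) \<longrightarrow>
      coord_risk n (scaled_law h (\<sigma> k)) (f0 k)
      \<le> ennreal (C4 * l ^ Suc q * ((f0 k)\<^sup>2 + real k powr (- 1 - 2 * \<beta>))))"
    if n: "1 \<le> n" and k: "1 \<le> k" and l_def: "l = 1 + ln (real n) + ln (real k)" for n k l
  proof -
    let ?\<mu> = "scaled_law h (\<sigma> k)"
    let ?a = "f0 k"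
    define w where "w = real k powr (- 1 - 2 * \<beta>)"
    define E where "E = ln (1 / ball_mass n k)"
    have w0: "0 \<le> w" by (simp add: w_def)
    have n0: "0 < n" using n by simp
    have lnk: "0 \<le> ln (real n)" "0 \<le> ln (real k)" using n k by auto
    have l1: "1 \<le> l" using lnk by (simp add: l_def)
    have lq: "1 \<le> l ^ q" "l ^ q \<le> l ^ Suc q" "l \<le> l ^ Suc q" "1 \<le> l ^ Suc q"
      using power_increasing[of q "Suc q" l] power_increasing[of 1 "Suc q" l]
        one_le_power[OF l1, of q] one_le_power[OF l1, of "Suc q"] l1
      by (simp_all del: power_Suc)
    note s = \<sigma>_pos[OF k] \<sigma>_le_1[OF k]
    have \<mu>: "prob_space ?\<mu>" "sets ?\<mu> = sets borel"
      by (auto intro!: prob_space_scaled_law simp: h_density)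
    have m: "0 < ball_mass n k" "ball_mass n k \<le> measure ?\<mu> {\<theta>. \<bar>\<theta> - ?a\<bar> \<le> 1 / sqrt (real n)}"
      using scaled_law_ball_ge[OF s n0] n0 h_pos by (auto simp: ball_mass_def)
    have E: "E \<le> C * l ^ q" using mass[OF n k] by (simp add: E_def l_def)
    have "26 + 8 * E \<le> 26 * l ^ q + 8 * (C * l ^ q)" using E lq by linarith
    then have E1: "26 + 8 * E \<le> C1 * l ^ q" by (simp add: C1_def algebra_simps)
    have "96 + 8 * E \<le> 96 * l ^ q + 8 * (C * l ^ q)" using E lq by linarith
    then have E3: "2 * (96 + 8 * E) \<le> C3 * l ^ q" by (simp add: C3_def algebra_simps)
    have risk: "coord_risk n ?\<mu> ?a \<le> ennreal ((26 + 8 * E) / real n)"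
      unfolding E_def by (rule coord_risk_le[OF \<mu> n0 m])
    have q0: "0 \<le> l ^ q" "0 \<le> l ^ Suc q" using lq by linarith+
    have risk1: "coord_risk n ?\<mu> ?a \<le> ennreal (C1 * l ^ q / real n)"
      using E1 by (intro order_trans[OF risk] ennreal_leI divide_right_mono) auto
    have "C1 * l ^ q \<le> C4 * l ^ Suc q"
      using Cn lq q0 by (intro mult_mono) (auto simp: C4_def)
    then have first: "coord_risk n ?\<mu> ?a \<le> ennreal (C4 * l ^ Suc q / real n)"
      by (intro order_trans[OF risk1] ennreal_leI divide_right_mono) auto
    have second: "coord_risk n ?\<mu> ?a \<le> ennreal (C4 * l ^ Suc q * (?a\<^sup>2 + w))"
      if hf: "real n \<le> real k powr (2 * \<beta> + 1)"
    proof -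
      define T where "T = sqrt (b * l)"
      have bl: "1 \<le> b * l" using b l1 mult_mono[of 8 b 1 l] by linarith
      have T2: "T\<^sup>2 = b * l" using bl by (simp add: T_def)
      have T1: "1 \<le> T" using bl by (simp add: T_def)
      have Tle: "T \<le> b * l" using T1 T2 mult_left_mono[of 1 T T] by (simp add: power2_eq_square)
      have C4w: "C1 * b * ?a\<^sup>2 \<le> C4 * (?a\<^sup>2 + w)"
        using Cn w0 by (intro mult_mono) (auto simp: C4_def)
      show ?thesis
      proof (cases "\<bar>?a\<bar> * T * sqrt (real n) \<le> 1")
        case True
        have "\<sigma> k ^ 2 \<le> (A * real k powr (- 1 / 2 - \<beta>))\<^sup>2"
          using s \<sigma>_decay[OF k] by (intro power_mono) auto
        also have "\<dots> = A\<^sup>2 * (real k powr (- 1 / 2 - \<beta>) * real k powr (- 1 / 2 - \<beta>))"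
          by (simp add: power2_eq_square mult_ac)
        also have "real k powr (- 1 / 2 - \<beta>) * real k powr (- 1 / 2 - \<beta>) = w"
          unfolding w_def powr_add[symmetric] by (rule arg_cong[of _ _ "(powr) (real k)"]) (simp add: field_simps)
        finally have \<sigma>w: "(\<sigma> k)\<^sup>2 \<le> A\<^sup>2 * w" .
        \<comment> \<open>Beyond the cutoff the prior standard deviation is at most A times the
          noise level, so the prior mean of the likelihood ratio at observation 0 stays above the
          fixed constant \<open>c\<close>.\<close>
        have "real n * (\<sigma> k)\<^sup>2 \<le> real k powr (2 * \<beta> + 1) * (A\<^sup>2 * w)"
          using \<sigma>w hf by (intro mult_mono) auto
        also have "\<dots> = A\<^sup>2 * (real k powr (2 * \<beta> + 1) * w)" by (simp only: mult_ac)
        also have "real k powr (2 * \<beta> + 1) * w = 1"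
          unfolding w_def powr_add[symmetric] using k by simp
        finally have B: "real n * (\<sigma> k)\<^sup>2 \<le> A\<^sup>2" by simp
        have gm: "ennreal c \<le> (\<integral>\<^sup>+ \<theta>. ennreal (exp (- real n * \<theta>\<^sup>2 / 2)) \<partial>?\<mu>)"
          unfolding c_def by (rule scaled_law_gaussian_mean_ge[OF B])
        have v: "0 \<le> (\<sigma> k)\<^sup>2 * m2" using m2_nonneg by simp
        have "coord_risk n ?\<mu> ?a \<le> ennreal (2 * ?a\<^sup>2 + 18 * T * ((\<sigma> k)\<^sup>2 * m2) / c
            + 2 * exp (- T\<^sup>2 / 8) * (96 + 8 * E) / real n)"
          unfolding E_def
          by (rule coord_risk_small_parameter_le[OF \<mu> n0 m scaled_law_symmetric[OF h_meas h_sym] c gm v _ T1 True])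
             (simp add: scaled_law_second_moment)
        also have "\<dots> \<le> ennreal (C4 * l ^ Suc q * (?a\<^sup>2 + w))"
        proof (intro ennreal_leI)
          have 1: "2 * ?a\<^sup>2 \<le> 2 * l ^ Suc q * ?a\<^sup>2"
            using lq by (intro mult_right_mono) auto
          have "18 * T * ((\<sigma> k)\<^sup>2 * m2) / c \<le> 18 * (b * l) * (A\<^sup>2 * w * m2) / c"
            using Tle \<sigma>w m2_nonneg c T1 w0 by (intro divide_right_mono mult_mono) auto
          also have "\<dots> = C2 * l * w" by (simp add: C2_def)
          also have "\<dots> \<le> C2 * l ^ Suc q * w"
            using Cn lq w0 by (intro mult_right_mono mult_left_mono) auto
          finally have 2: "18 * T * ((\<sigma> k)\<^sup>2 * m2) / c \<le> C2 * l ^ Suc q * w" .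
          have "- T\<^sup>2 / 8 = (- 1 - 2 * \<beta>) * l" unfolding T2 by (simp add: b_def field_simps)
          also have "\<dots> \<le> (- 1 - 2 * \<beta>) * ln (real k)"
            using \<beta> lnk by (intro mult_left_mono_neg) (auto simp: l_def)
          finally have ew: "exp (- T\<^sup>2 / 8) \<le> w" using k by (simp add: w_def powr_def)
          have "2 * exp (- T\<^sup>2 / 8) * (96 + 8 * E) / real n = exp (- T\<^sup>2 / 8) * (2 * (96 + 8 * E)) / real n"
            by simp
          \<comment> \<open>The factor 1/n is given up here: w alone already has the order of the
            prior variance.\<close>
          also have "\<dots> \<le> w * (C3 * l ^ Suc q) / 1"
          proof -
            have "C3 * l ^ q \<le> C3 * l ^ Suc q" using Cn lq by (intro mult_left_mono) auto
            then have "exp (- T\<^sup>2 / 8) * (2 * (96 + 8 * E)) \<le> exp (- T\<^sup>2 / 8) * (C3 * l ^ Suc q)"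
              using E3 by (intro mult_left_mono) auto
            also have "\<dots> \<le> w * (C3 * l ^ Suc q)"
              using ew Cn q0 by (intro mult_right_mono) auto
            finally have 4: "exp (- T\<^sup>2 / 8) * (2 * (96 + 8 * E)) \<le> w * (C3 * l ^ Suc q)" .
            have "exp (- T\<^sup>2 / 8) * (2 * (96 + 8 * E)) / real n \<le> w * (C3 * l ^ Suc q) / real n"
              using 4 by (rule divide_right_mono) simp
            also have "\<dots> \<le> w * (C3 * l ^ Suc q) / 1"
              using n w0 Cn q0 by (intro divide_left_mono) auto
            finally show ?thesis .
          qed
          finally have 3: "2 * exp (- T\<^sup>2 / 8) * (96 + 8 * E) / real n \<le> C3 * l ^ Suc q * w"
            by (simp add: mult_ac)
          have "2 * ?a\<^sup>2 + 18 * T * ((\<sigma> k)\<^sup>2 * m2) / c + 2 * exp (- T\<^sup>2 / 8) * (96 + 8 * E) / real n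
            \<le> l ^ Suc q * (2 * ?a\<^sup>2 + C2 * w + C3 * w)"
            using 1 2 3 by (simp add: algebra_simps)
          also have "\<dots> \<le> l ^ Suc q * (C4 * ?a\<^sup>2 + C4 * w)"
          proof (intro mult_left_mono q0)
            have "(C2 + C3) * w \<le> C4 * w" "2 * ?a\<^sup>2 \<le> C4 * ?a\<^sup>2"
              using Cn w0 by (intro mult_right_mono, auto simp: C4_def)+
            then show "2 * ?a\<^sup>2 + C2 * w + C3 * w \<le> C4 * ?a\<^sup>2 + C4 * w"
              by (simp add: algebra_simps)
          qed
          finally show "2 * ?a\<^sup>2 + 18 * T * ((\<sigma> k)\<^sup>2 * m2) / c + 2 * exp (- T\<^sup>2 / 8) * (96 + 8 * E) / real n
            \<le> C4 * l ^ Suc q * (?a\<^sup>2 + w)" by (simp add: algebra_simps)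
        qed
        finally show ?thesis .
      next
        case False
        then have "1 \<le> (\<bar>?a\<bar> * T * sqrt (real n))\<^sup>2" by (intro one_le_power) auto
        also have "\<dots> = ?a\<^sup>2 * (b * l) * real n" by (simp add: power_mult_distrib T2)
        finally have "1 / real n \<le> ?a\<^sup>2 * (b * l)" using n0 by (simp add: field_simps)
        then have "C1 * l ^ q * (1 / real n) \<le> C1 * l ^ q * (?a\<^sup>2 * (b * l))"
          using Cn q0 by (intro mult_left_mono) auto
        also have "\<dots> = l ^ Suc q * (C1 * b * ?a\<^sup>2)" by (simp add: mult_ac)
        also have "\<dots> \<le> l ^ Suc q * (C4 * (?a\<^sup>2 + w))"
          using C4w q0 by (intro mult_left_mono) auto
        finally have "C1 * l ^ q / real n \<le> C4 * l ^ Suc q * (?a\<^sup>2 + w)" by (simp add: mult_ac)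
        then show ?thesis by (intro order_trans[OF risk1] ennreal_leI)
      qed
    qed
    show ?thesis using first second unfolding w_def by blast
  qed
  show ?thesis
  proof (intro exI[of _ C4] exI[of _ "Suc q"] conjI allI impI)
    show "1 \<le> C4" using Cn by (simp add: C4_def)
  qed (use *[OF _ _ refl] in auto)
qed

end

section \<open>Summation over the frequencies\<close>

text \<open>With t = y powr (\<beta> / q), ln y = (q / \<beta>) ln t \<le> (q / \<beta>) t, and t ^
  q = y powr \<beta>. It is applied to y = k / K, to absorb the part of the logarithm that n does
  not control.\<close>

lemma one_plus_ln_power_le:
  assumes \<beta>: "0 < \<beta>" and q: "1 \<le> q" and y: "1 \<le> y"
  shows "(1 + ln y) ^ q \<le> (1 + real q / \<beta>) ^ q * y powr \<beta>"
proof -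
  define t where "t = y powr (\<beta> / real q)"
  have t1: "1 \<le> t" using \<beta> q y by (simp add: t_def ge_one_powr_ge_zero)
  have "\<beta> / real q * ln y = ln t" using y by (simp add: t_def ln_powr)
  also have "\<dots> \<le> t" using t1 ln_le_minus_one[of t] by linarith
  finally have "ln y \<le> real q / \<beta> * t" using \<beta> q by (simp add: field_simps)
  then have "1 + ln y \<le> (1 + real q / \<beta>) * t" using t1 by (simp add: distrib_right)
  then have "(1 + ln y) ^ q \<le> ((1 + real q / \<beta>) * t) ^ q"
    using y by (intro power_mono) auto
  also have "\<dots> = (1 + real q / \<beta>) ^ q * t ^ q" by (rule power_mult_distrib)
  also have "t ^ q = y powr \<beta>"
    using q y by (simp add: t_def powr_realpow[symmetric] powr_powr)
  finally show ?thesis .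
qed

text \<open>The mean value theorem writes the difference on the right as \<beta> * z powr (- \<beta>
  - 1) with z between x and x + 1. Since x \<ge> 1, z is at most 2 x, which costs the factor 2 powr
  (1 + \<beta>).\<close>

lemma powr_le_telescope:
  fixes \<beta> x :: real
  assumes \<beta>: "0 < \<beta>" and x: "1 \<le> x"
  shows "x powr (- 1 - \<beta>) \<le> 2 powr (1 + \<beta>) / \<beta> * (x powr - \<beta> - (x + 1) powr - \<beta>)"
proof -
  have "\<exists>z. x < z \<and> z < x + 1 \<and> (x + 1) powr - \<beta> - x powr - \<beta> = (x + 1 - x) * (- \<beta> * z powr (- \<beta> - 1))"
    using x by (intro MVT2[where f="\<lambda>x::real. x powr - \<beta>" and f'="\<lambda>z. - \<beta> * z powr (- \<beta> - 1)"])
      (auto intro!: derivative_eq_intros simp: powr_diff field_simps)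
  then obtain z where z: "x < z" "z < x + 1" and eq: "x powr - \<beta> - (x + 1) powr - \<beta> = \<beta> * z powr (- \<beta> - 1)"
    by auto
  have "x powr (- 1 - \<beta>) = 2 powr (1 + \<beta>) * (2 * x) powr (- 1 - \<beta>)"
    using x by (simp add: powr_mult powr_add[symmetric] mult.assoc[symmetric])
  also have "\<dots> \<le> 2 powr (1 + \<beta>) * z powr (- 1 - \<beta>)"
    using x z \<beta> by (intro mult_left_mono powr_mono2') auto
  also have "\<dots> = 2 powr (1 + \<beta>) / \<beta> * (x powr - \<beta> - (x + 1) powr - \<beta>)"
  proof -
    have "z powr (- \<beta> - 1) = z powr (- 1 - \<beta>)" by (rule arg_cong[of _ _ "(powr) z"]) simp
    then show ?thesis unfolding eq using \<beta> by simp
  qed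
  finally show ?thesis .
qed

text \<open>The frequencies below the cutoff K and the tail sum of k powr (- 1 - \<beta>) above it are both
  dominated by telescoping series, built from min k K and min (k powr - \<beta>) (K powr - \<beta>).\<close>

lemma frequency_sum_le:
  fixes f :: "nat \<Rightarrow> real"
  assumes \<beta>: "0 < \<beta>" and C: "0 \<le> C" and q: "1 \<le> q" and f: "f \<in> sobolev_ball \<beta> L"
  shows "\<exists>D>0. \<forall>n\<ge>1. \<forall>R :: nat \<Rightarrow> ennreal.
    (\<forall>k\<ge>1. R k \<le> ennreal (C * (1 + ln (real n) + ln (real k)) ^ q *
      (if real n \<le> real k powr (2 * \<beta> + 1) then (f k)\<^sup>2 + real k powr (- 1 - 2 * \<beta>) else 1 / real n))) \<longrightarrow>
    (\<Sum>j. R (Suc j)) \<le> ennreal (D * (1 + ln (real n)) ^ q * real n powr (- 2 * \<beta> / (2 * \<beta> + 1)))"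
proof -
  define B where "B = (1 + real q / \<beta>) ^ q"
  define M where "M = 2 powr (1 + \<beta>) / \<beta>"
  \<comment> \<open>The summands 1, L^2 and M come from the low frequencies, the Sobolev tail and
    the prior variances; the final 1 keeps \<open>D\<close> positive even for
    \<open>C = 0\<close>.\<close>
  define D where "D = C * 2 ^ q * B * (1 + L\<^sup>2 + M) + 1"
  have B: "1 \<le> B" using \<beta> by (simp add: B_def one_le_power)
  have M: "0 < M" using \<beta> by (simp add: M_def)
  have D: "0 < D" using C B M unfolding D_def by (intro add_nonneg_pos mult_nonneg_nonneg) auto
  let ?g = "\<lambda>j. real (Suc j) powr (2 * \<beta>) * (f (Suc j))\<^sup>2"
  have g: "summable ?g" "(\<Sum>j. ?g j) \<le> L\<^sup>2" using f by (auto simp: sobolev_ball_def)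
  have "(\<Sum>j. R (Suc j)) \<le> ennreal (D * (1 + ln (real n)) ^ q * real n powr (- 2 * \<beta> / (2 * \<beta> + 1)))"
    if n: "1 \<le> n" and R: "\<forall>k\<ge>1. R k \<le> ennreal (C * (1 + ln (real n) + ln (real k)) ^ q *
      (if real n \<le> real k powr (2 * \<beta> + 1) then (f k)\<^sup>2 + real k powr (- 1 - 2 * \<beta>) else 1 / real n))"
    for n and R :: "nat \<Rightarrow> ennreal"
  proof -
    define K where "K = real n powr (1 / (2 * \<beta> + 1))"
    define \<Lambda> where "\<Lambda> = 1 + ln (real n)"
    have K1: "1 \<le> K" using n \<beta> by (simp add: K_def ge_one_powr_ge_zero)
    have lnn: "0 \<le> ln (real n)" using n by simp
    have \<Lambda>1: "1 \<le> \<Lambda>" using lnn by (simp add: \<Lambda>_def)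
    have Kn: "K powr (2 * \<beta> + 1) = real n" using n \<beta> by (simp add: K_def powr_powr)
    have rate: "real n powr (- 2 * \<beta> / (2 * \<beta> + 1)) = K powr (- 2 * \<beta>)"
      using \<beta> by (simp add: K_def powr_powr)
    have K_div_n: "K / real n = K powr (- 2 * \<beta>)"
    proof -
      have "K / real n = K powr 1 / K powr (2 * \<beta> + 1)" using K1 Kn by simp
      also have "\<dots> = K powr (- 2 * \<beta>)" unfolding powr_diff[symmetric] by simp
      finally show ?thesis .
    qed
    have cutoff: "real n \<le> real k powr (2 * \<beta> + 1) \<longleftrightarrow> K \<le> real k" for k
    proof -
      have "real n \<le> real k powr (2 * \<beta> + 1) \<longleftrightarrow> K powr (2 * \<beta> + 1) \<le> real k powr (2 * \<beta> + 1)"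
        by (simp add: Kn)
      also have "\<dots> \<longleftrightarrow> K \<le> real k"
        using K1 \<beta> powr_mono2[of "2 * \<beta> + 1" K "real k"] powr_less_mono2[of "2 * \<beta> + 1" "real k" K]
        by (cases "K \<le> real k") auto
      finally show ?thesis .
    qed
    have lnK: "ln K \<le> ln (real n)"
      using n \<beta> lnn by (simp add: K_def ln_powr field_simps)
    \<comment> \<open>Equal to 1 as long as k = Suc j is below K, with total K. In contrast
      \<open>u j\<close> belongs to k = Suc j itself; it is constant up to K and its decrements sum
      to \<open>u 0 \<le> K powr - \<beta>\<close>.\<close>
    define t1 where "t1 = (\<lambda>j. min (real (Suc j)) K - min (real j) K)"
    define u where "u = (\<lambda>j. min (real (Suc j) powr - \<beta>) (K powr - \<beta>))"
    define s where "s = (\<lambda>j. 1 / real n * t1 j + K powr (- 2 * \<beta>) * ?g j + M * K powr - \<beta> * (u j - u (Suc j)))"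
    have t1_0: "0 \<le> t1 j" for j by (simp add: t1_def)
    have u_dec: "0 \<le> u j - u (Suc j)" for j
      using \<beta> powr_mono2'[of "- \<beta>" "real (Suc j)" "real (Suc (Suc j))"] by (auto simp: u_def min_def)
    have bound: "C * (1 + ln (real n) + ln (real (Suc j))) ^ q *
      (if real n \<le> real (Suc j) powr (2 * \<beta> + 1) then (f (Suc j))\<^sup>2 + real (Suc j) powr (- 1 - 2 * \<beta>) else 1 / real n)
      \<le> C * 2 ^ q * B * \<Lambda> ^ q * s j" for j
    proof -
      define k where "k = Suc j"
      have k: "1 \<le> real k" "real k = real j + 1" by (simp_all add: k_def)
      define l where "l = 1 + ln (real n) + ln (real k)"
      have l0: "0 \<le> l" using lnn k by (simp add: l_def)
      have s0: "0 \<le> 1 / real n * t1 j" "0 \<le> K powr (- 2 * \<beta>) * ?g j" "0 \<le> M * K powr - \<beta> * (u j - u (Suc j))"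
        using t1_0 u_dec M by (auto intro!: mult_nonneg_nonneg simp del: u_def)
      have "l ^ q * (if K \<le> real k then (f k)\<^sup>2 + real k powr (- 1 - 2 * \<beta>) else 1 / real n) \<le> 2 ^ q * B * \<Lambda> ^ q * s j"
      proof (cases "K \<le> real k")
        case True
        \<comment> \<open>Splitting ln k = ln K + ln y separates the part controlled by ln n from
          the part that grows along the series.\<close>
        define y where "y = real k / K"
        have y1: "1 \<le> y" using True K1 by (simp add: y_def)
        have "ln (real k) = ln K + ln y" using k K1 by (simp add: y_def ln_div)
        then have "l \<le> \<Lambda> + \<Lambda> + ln y" using lnK lnn by (simp add: l_def \<Lambda>_def)
        also have "\<dots> \<le> 2 * \<Lambda> + 2 * \<Lambda> * ln y"
        proof -
          have "1 * ln y \<le> (2 * \<Lambda>) * ln y" using \<Lambda>1 y1 by (intro mult_right_mono) auto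
          then show ?thesis by simp
        qed
        also have "\<dots> = 2 * \<Lambda> * (1 + ln y)" by (simp add: algebra_simps)
        finally have "l ^ q \<le> (2 * \<Lambda> * (1 + ln y)) ^ q" using l0 by (intro power_mono) auto
        also have "\<dots> = 2 ^ q * \<Lambda> ^ q * (1 + ln y) ^ q" by (simp add: power_mult_distrib)
        also have "\<dots> \<le> 2 ^ q * \<Lambda> ^ q * (B * y powr \<beta>)"
          unfolding B_def using \<Lambda>1 by (intro mult_left_mono one_plus_ln_power_le \<beta> q y1) auto
        finally have l: "l ^ q \<le> 2 ^ q * B * \<Lambda> ^ q * y powr \<beta>" by (simp add: mult_ac)
        \<comment> \<open>Since y \<ge> 1, the factor y powr \<beta> is at most y powr (2 *
          \<beta>), which is exactly the Sobolev weight up to K powr (- 2 * \<beta>).\<close>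
        have 1: "y powr \<beta> * (f k)\<^sup>2 \<le> K powr (- 2 * \<beta>) * ?g j"
        proof -
          have "y powr \<beta> \<le> y powr (2 * \<beta>)" using \<beta> y1 by (intro powr_mono) auto
          also have "\<dots> = K powr (- 2 * \<beta>) * real k powr (2 * \<beta>)"
            using K1 k by (simp add: y_def powr_divide powr_minus field_simps)
          finally have "y powr \<beta> * (f k)\<^sup>2 \<le> K powr (- 2 * \<beta>) * real k powr (2 * \<beta>) * (f k)\<^sup>2"
            by (rule mult_right_mono) simp
          then show ?thesis by (simp add: k_def mult_ac)
        qed
        \<comment> \<open>Absorbing the logarithm uses up \<beta> of the decay; the remaining k powr
          (- 1 - \<beta>) is still summable, and its tail K powr - \<beta> joins the factor K powr -
          \<beta> from y.\<close>
        have 2: "y powr \<beta> * real k powr (- 1 - 2 * \<beta>) \<le> M * K powr - \<beta> * (u j - u (Suc j))"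
        proof -
          have "y powr \<beta> * real k powr (- 1 - 2 * \<beta>) = K powr - \<beta> * (real k powr \<beta> * real k powr (- 1 - 2 * \<beta>))"
            using K1 k by (simp add: y_def powr_divide powr_minus field_simps)
          also have "real k powr \<beta> * real k powr (- 1 - 2 * \<beta>) = real k powr (- 1 - \<beta>)"
            unfolding powr_add[symmetric] by (rule arg_cong[of _ _ "(powr) (real k)"]) simp
          also have "K powr - \<beta> * real k powr (- 1 - \<beta>) \<le> K powr - \<beta> * (M * (real k powr - \<beta> - (real k + 1) powr - \<beta>))"
            unfolding M_def using powr_le_telescope[OF \<beta> k(1)] by (intro mult_left_mono) auto
          also have "real k powr - \<beta> - (real k + 1) powr - \<beta> = u j - u (Suc j)"
          proof -
            have "real k powr - \<beta> \<le> K powr - \<beta>" "(real k + 1) powr - \<beta> \<le> K powr - \<beta>"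
              using \<beta> True K1 by (intro powr_mono2'; simp)+
            moreover have "real (Suc (Suc j)) = real k + 1" by (simp add: k_def)
            ultimately show ?thesis by (simp only: u_def min_absorb1 k_def)
          qed
          finally show ?thesis by (simp add: mult_ac)
        qed
        have "l ^ q * ((f k)\<^sup>2 + real k powr (- 1 - 2 * \<beta>))
          \<le> 2 ^ q * B * \<Lambda> ^ q * y powr \<beta> * ((f k)\<^sup>2 + real k powr (- 1 - 2 * \<beta>))"
          using l by (intro mult_right_mono) auto
        also have "\<dots> = 2 ^ q * B * \<Lambda> ^ q * (y powr \<beta> * (f k)\<^sup>2 + y powr \<beta> * real k powr (- 1 - 2 * \<beta>))"
          by (simp add: algebra_simps)
        also have "\<dots> \<le> 2 ^ q * B * \<Lambda> ^ q * s j"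
          unfolding s_def using 1 2 s0(1) B \<Lambda>1 by (intro mult_left_mono) (linarith, auto)
        finally show ?thesis using True by simp
      next
        case False
        then have "ln (real k) \<le> ln K" using k by simp
        then have "l \<le> 2 * \<Lambda>" using lnK by (simp add: l_def \<Lambda>_def)
        then have "l ^ q \<le> (2 * \<Lambda>) ^ q" using l0 by (intro power_mono)
        also have "\<dots> = 2 ^ q * 1 * \<Lambda> ^ q" by (simp add: power_mult_distrib)
        also have "\<dots> \<le> 2 ^ q * B * \<Lambda> ^ q" using B \<Lambda>1 by (intro mult_right_mono mult_left_mono) auto
        finally have l: "l ^ q \<le> 2 ^ q * B * \<Lambda> ^ q" .
        have "t1 j = 1" using False k by (simp add: t1_def min_def)
        then have "1 / real n \<le> s j" using s0 by (simp add: s_def)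
        then have "l ^ q * (1 / real n) \<le> 2 ^ q * B * \<Lambda> ^ q * s j"
          using l l0 B \<Lambda>1 by (intro mult_mono) auto
        then show ?thesis using False by simp
      qed
      from mult_left_mono[OF this C] show ?thesis
        unfolding cutoff k_def[symmetric] l_def[symmetric] by (simp only: mult_ac)
    qed
    have t1_sums: "t1 sums (K - min (real 0) K)"
    proof -
      have "\<forall>\<^sub>F j in sequentially. K = min (real j) K"
        using eventually_ge_at_top[of "nat \<lceil>K\<rceil>"] by eventually_elim (auto simp: min_def)
      then have "(\<lambda>j. min (real j) K) \<longlonglongrightarrow> K" by (rule Lim_transform_eventually[OF tendsto_const])
      then show ?thesis unfolding t1_def by (rule telescope_sums)
    qed
    have u_sums: "(\<lambda>j. u j - u (Suc j)) sums (u 0 - min 0 (K powr - \<beta>))"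
    proof -
      have "(\<lambda>j. real j powr - \<beta>) \<longlonglongrightarrow> 0"
        using \<beta> by (intro tendsto_neg_powr filterlim_real_sequentially) auto
      then have "(\<lambda>j. real (Suc j) powr - \<beta>) \<longlonglongrightarrow> 0" by (rule LIMSEQ_Suc)
      then have "u \<longlonglongrightarrow> min 0 (K powr - \<beta>)" unfolding u_def by (intro tendsto_min tendsto_const)
      then show ?thesis by (rule telescope_sums')
    qed
    have s_sums: "s sums (1 / real n * (K - min (real 0) K) + K powr (- 2 * \<beta>) * (\<Sum>j. ?g j) + M * K powr - \<beta> * (u 0 - min 0 (K powr - \<beta>)))"
      unfolding s_def by (intro sums_add sums_mult t1_sums u_sums summable_sums g)
    have "suminf s = K / real n + K powr (- 2 * \<beta>) * (\<Sum>j. ?g j) + M * K powr - \<beta> * u 0"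
      using sums_unique[OF s_sums] K1 by simp
    also have "\<dots> \<le> K powr (- 2 * \<beta>) + K powr (- 2 * \<beta>) * L\<^sup>2 + M * K powr - \<beta> * K powr - \<beta>"
      unfolding K_div_n using g M by (intro add_mono mult_left_mono) (auto simp: u_def)
    also have "M * K powr - \<beta> * K powr - \<beta> = M * K powr (- 2 * \<beta>)"
      by (simp add: mult.assoc powr_add[symmetric])
    finally have s_le: "suminf s \<le> (1 + L\<^sup>2 + M) * K powr (- 2 * \<beta>)" by (simp add: algebra_simps)
    let ?c = "C * 2 ^ q * B * \<Lambda> ^ q"
    have c0: "0 \<le> ?c" using C B \<Lambda>1 by (intro mult_nonneg_nonneg) auto
    have s0: "0 \<le> s j" for j
      unfolding s_def using t1_0 u_dec M by (intro add_nonneg_nonneg mult_nonneg_nonneg) auto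
    have sum: "summable (\<lambda>j. ?c * s j)" by (intro summable_mult sums_summable[OF s_sums])
    have "(\<Sum>j. R (Suc j)) \<le> (\<Sum>j. ennreal (?c * s j))"
    proof (intro suminf_le summableI)
      fix j
      have "R (Suc j) \<le> ennreal (C * (1 + ln (real n) + ln (real (Suc j))) ^ q *
        (if real n \<le> real (Suc j) powr (2 * \<beta> + 1) then (f (Suc j))\<^sup>2 + real (Suc j) powr (- 1 - 2 * \<beta>) else 1 / real n))"
        by (rule R[rule_format]) simp
      also have "\<dots> \<le> ennreal (?c * s j)" by (rule ennreal_leI[OF bound])
      finally show "R (Suc j) \<le> ennreal (?c * s j)" .
    qed
    also have "\<dots> = ennreal (\<Sum>j. ?c * s j)"
      using sum c0 s0 by (intro suminf_ennreal2) auto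
    also have "(\<Sum>j. ?c * s j) = ?c * suminf s"
      by (rule suminf_mult[OF sums_summable[OF s_sums]])
    also have "ennreal (?c * suminf s) \<le> ennreal (D * \<Lambda> ^ q * K powr (- 2 * \<beta>))"
    proof (rule ennreal_leI)
      have "?c * suminf s \<le> ?c * ((1 + L\<^sup>2 + M) * K powr (- 2 * \<beta>))" by (rule mult_left_mono[OF s_le c0])
      also have "\<dots> = (D - 1) * \<Lambda> ^ q * K powr (- 2 * \<beta>)" by (simp add: D_def algebra_simps)
      also have "\<dots> \<le> D * \<Lambda> ^ q * K powr (- 2 * \<beta>)" using \<Lambda>1 by (intro mult_right_mono) auto
      finally show "?c * suminf s \<le> D * \<Lambda> ^ q * K powr (- 2 * \<beta>)" .
    qed
    finally show ?thesis unfolding rate \<Lambda>_def .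
  qed
  then show ?thesis using D by blast
qed

section \<open>Contraction of the posterior\<close>

context heavy_tailed_prior
begin

text \<open>Allowing each coordinate above n to be set to 0 treats the full and the truncated prior
  at once with the same d. The choice d = q works because the squared radius carries the power 2 q
  of ln n while the total risk carries only the power q of 1 + ln n; the surplus drives the quotient
  to 0.\<close>

lemma posterior_contraction:
  "\<exists>d>0. \<forall>\<pi>. (\<forall>n k. 1 \<le> k \<longrightarrow> \<pi> n k = series_prior h \<sigma> k \<or> (n < k \<and> \<pi> n k = return borel 0)) \<longrightarrow>
    (\<lambda>n. expected_posterior_mass_outside n (\<pi> n) f0
      (ln (real n) powr d * real n powr (- \<beta> / (2 * \<beta> + 1)))) \<longlonglongrightarrow> 0"
proof -
  obtain C q where C: "1 \<le> C" and q: "1 \<le> q" and risk: "\<And>n k. 1 \<le> n \<Longrightarrow> 1 \<le> k \<Longrightarrow>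
    coord_risk n (scaled_law h (\<sigma> k)) (f0 k)
      \<le> ennreal (C * (1 + ln (real n) + ln (real k)) ^ q / real n) \<and>
    (real n \<le> real k powr (2 * \<beta> + 1) \<longrightarrow>
      coord_risk n (scaled_law h (\<sigma> k)) (f0 k)
      \<le> ennreal (C * (1 + ln (real n) + ln (real k)) ^ q * ((f0 k)\<^sup>2 + real k powr (- 1 - 2 * \<beta>))))"
    using coord_risk_series_prior by blast
  obtain D where D: "0 < D" and total: "\<And>n R. 1 \<le> n \<Longrightarrow>
    (\<forall>k\<ge>1. R k \<le> ennreal (C * (1 + ln (real n) + ln (real k)) ^ q *
      (if real n \<le> real k powr (2 * \<beta> + 1) then (f0 k)\<^sup>2 + real k powr (- 1 - 2 * \<beta>) else 1 / real n))) \<Longrightarrow>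
    (\<Sum>j. R (Suc j)) \<le> ennreal (D * (1 + ln (real n)) ^ q * real n powr (- 2 * \<beta> / (2 * \<beta> + 1)))"
    using frequency_sum_le[OF \<beta> _ q f0, of C] C by auto
  have "(\<lambda>n. expected_posterior_mass_outside n (\<pi> n) f0
      (ln (real n) powr real q * real n powr (- \<beta> / (2 * \<beta> + 1)))) \<longlonglongrightarrow> 0"
    if \<pi>: "\<forall>n k. 1 \<le> k \<longrightarrow> \<pi> n k = series_prior h \<sigma> k \<or> (n < k \<and> \<pi> n k = return borel 0)" for \<pi>
  proof (rule real_tendsto_sandwich)
    let ?r = "\<lambda>n. ln (real n) powr real q * real n powr (- \<beta> / (2 * \<beta> + 1))"
    show "\<forall>\<^sub>F n in sequentially. 0 \<le> expected_posterior_mass_outside n (\<pi> n) f0 (?r n)"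
      by (simp add: expected_posterior_mass_outside_def)
    show "\<forall>\<^sub>F n in sequentially. expected_posterior_mass_outside n (\<pi> n) f0 (?r n) \<le> D * 2 ^ q / ln (real n)"
      \<comment> \<open>From 3 \<ge> exp 1 on, ln n \<ge> 1, so that 1 + ln n \<le> 2 ln n and ln n
        \<le> (ln n) ^ q.\<close>
      using eventually_ge_at_top[of 3]
    proof eventually_elim
      case (elim n)
      then have n: "1 \<le> n" "0 < n" by auto
      have "exp 1 \<le> real n" using exp_le elim by linarith
      then have ln1: "1 \<le> ln (real n)" using n by (simp add: ln_ge_iff)
      have prob: "prob_space (\<pi> n k)" if "1 \<le> k" for k
        using \<pi>[rule_format, OF that, of n] h_density
        by (auto simp: series_prior_def intro!: prob_space_scaled_law prob_space_return)
      have sets: "sets (\<pi> n k) = sets borel" if "1 \<le> k" for k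
        using \<pi>[rule_format, OF that, of n] by (auto simp: series_prior_def)
      have r: "0 < ?r n"
        using ln1 n by (intro mult_pos_pos powr_gt_zero[THEN iffD2]) linarith+
      let ?rate = "real n powr (- 2 * \<beta> / (2 * \<beta> + 1))"
      have r2: "(?r n)\<^sup>2 = ln (real n) ^ q * ln (real n) ^ q * ?rate"
      proof -
        have "ln (real n) powr real q = ln (real n) ^ q" using ln1 by (intro powr_realpow) linarith
        moreover have "(real n powr (- \<beta> / (2 * \<beta> + 1)))\<^sup>2 = ?rate"
          by (simp add: power2_eq_square powr_add[symmetric] add_divide_distrib[symmetric])
        ultimately show ?thesis by (simp add: power_mult_distrib power2_eq_square)
      qed
      have "coord_risk n (\<pi> n k) (f0 k) \<le> ennreal (C * (1 + ln (real n) + ln (real k)) ^ q *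
        (if real n \<le> real k powr (2 * \<beta> + 1) then (f0 k)\<^sup>2 + real k powr (- 1 - 2 * \<beta>) else 1 / real n))"
        if k: "1 \<le> k" for k
      proof (cases "\<pi> n k = series_prior h \<sigma> k")
        case True
        then show ?thesis using risk[OF n(1) k] by (simp add: series_prior_def)
      next
        case False
        \<comment> \<open>A coordinate set to 0 has risk (f0 k)^2. As k > n lies beyond the cutoff,
          this already occurs in the bound for high frequencies.\<close>
        then have nk: "n < k" and ret: "\<pi> n k = return borel 0" using \<pi> k by auto
        have "real k powr 1 \<le> real k powr (2 * \<beta> + 1)" using k \<beta> by (intro powr_mono) auto
        then have cut: "real n \<le> real k powr (2 * \<beta> + 1)" using nk k by simp
        have "1 \<le> (1 + ln (real n) + ln (real k)) ^ q" using n k by (intro one_le_power) simp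
        then have "1 * 1 \<le> C * (1 + ln (real n) + ln (real k)) ^ q" using C by (intro mult_mono) auto
        then have "1 * (f0 k)\<^sup>2 \<le> C * (1 + ln (real n) + ln (real k)) ^ q * ((f0 k)\<^sup>2 + real k powr (- 1 - 2 * \<beta>))"
          by (intro mult_mono) auto
        then show ?thesis using cut unfolding ret coord_risk_return_0[OF n(2)] by (simp add: ennreal_leI)
      qed
      then have sum: "(\<Sum>j. coord_risk n (\<pi> n (Suc j)) (f0 (Suc j))) \<le> ennreal (D * (1 + ln (real n)) ^ q * ?rate)"
        by (intro total[OF n(1), of "\<lambda>k. coord_risk n (\<pi> n k) (f0 k)"]) auto
      have "ennreal (expected_posterior_mass_outside n (\<pi> n) f0 (?r n))
        \<le> ennreal (D * (1 + ln (real n)) ^ q * ?rate) / ennreal ((?r n)\<^sup>2)"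
        by (rule order_trans[OF expected_posterior_mass_outside_le[OF prob sets n(2) r] divide_right_mono_ennreal[OF sum]])
      also have "\<dots> = ennreal (D * (1 + ln (real n)) ^ q * ?rate / (?r n)\<^sup>2)"
        using D ln1 r n by (intro divide_ennreal) auto
      finally have "expected_posterior_mass_outside n (\<pi> n) f0 (?r n) \<le> D * (1 + ln (real n)) ^ q * ?rate / (?r n)\<^sup>2"
        using D ln1 by (subst (asm) ennreal_le_iff) auto
      also have "\<dots> = D * (1 + ln (real n)) ^ q / (ln (real n) ^ q * ln (real n) ^ q)"
        unfolding r2 using n by simp
      also have "\<dots> \<le> D * (2 * ln (real n)) ^ q / (ln (real n) ^ q * ln (real n) ^ q)"
        using D ln1 by (intro divide_right_mono mult_left_mono power_mono) auto
      also have "\<dots> = D * 2 ^ q / ln (real n) ^ q"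
        using ln1 by (simp add: power_mult_distrib)
      also have "\<dots> \<le> D * 2 ^ q / ln (real n)"
        using D ln1 power_increasing[of 1 q "ln (real n)"] q by (intro divide_left_mono) auto
      finally show ?case .
    qed
    show "(\<lambda>n. D * 2 ^ q / ln (real n)) \<longlonglongrightarrow> 0"
      by (intro tendsto_divide_0[OF tendsto_const] filterlim_at_top_imp_at_infinity
          filterlim_compose[OF ln_at_top filterlim_real_sequentially])
  qed simp
  then show ?thesis using q by (intro exI[of _ "real q"]) auto
qed

end

section \<open>The two scale sequences\<close>

text \<open>Completing the square with b = 1 / 2 + \<beta>: - (ln k)^2 \<le> (b / 2)^2 - b ln k.
  Hence these scales decay faster than any power of k and suit every \<beta>.\<close>

lemma ln_square_prior_decay:
  assumes \<beta>: "0 \<le> \<beta>" and k: "1 \<le> k"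
  shows "exp (- (ln (real k))\<^sup>2) \<le> exp ((1 / 2 + \<beta>)\<^sup>2) * real k powr (- 1 / 2 - \<beta>)"
proof -
  define b where "b = 1 / 2 + \<beta>"
  have "0 \<le> (ln (real k) - b / 2)\<^sup>2" by simp
  then have "- (ln (real k))\<^sup>2 \<le> (b / 2)\<^sup>2 - b * ln (real k)"
    by (simp add: power2_eq_square algebra_simps)
  also have "\<dots> \<le> b\<^sup>2 + - b * ln (real k)" by (simp add: power_divide)
  finally have "exp (- (ln (real k))\<^sup>2) \<le> exp (b\<^sup>2) * exp (- b * ln (real k))"
    unfolding mult_exp_exp by simp
  also have "exp (- b * ln (real k)) = real k powr (- 1 / 2 - \<beta>)"
    using k by (simp add: powr_def b_def)
  finally show ?thesis by (simp add: b_def)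
qed

theorem theorem1:
  fixes h :: "real \<Rightarrow> real" and f0 :: "nat \<Rightarrow> real" and c1 \<kappa> \<beta> L :: real
  assumes h_meas: "h \<in> borel_measurable borel"
    and h_density: "(\<integral>\<^sup>+ x. ennreal (h x) \<partial>lborel) = 1"
    and h_sym: "\<And>x. h (- x) = h x"
    and h_pos: "\<And>x. 0 < h x"
    and h_bounded: "bounded (range h)"
    and h_decreasing: "\<And>x y. 0 \<le> x \<Longrightarrow> x \<le> y \<Longrightarrow> h y \<le> h x"
    and c1: "0 < c1" and \<kappa>: "0 \<le> \<kappa>"
    and h_tail: "\<And>x. 0 \<le> x \<Longrightarrow> ln (1 / h x) \<le> c1 * (1 + ln (1 + x) powr (1 + \<kappa>))"
    and h_second_moment: "integrable lborel (\<lambda>x. x\<^sup>2 * h x)"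
    and \<beta>: "0 < \<beta>" and L: "0 < L"
    and f0: "f0 \<in> sobolev_ball \<beta> L"
  shows
    "(\<exists>d>0. (\<lambda>n. expected_posterior_mass_outside n
          (series_prior h (\<lambda>k. exp (- (ln (real k))\<^sup>2)))
          f0 (ln (real n) powr d * real n powr (- \<beta> / (2 * \<beta> + 1)))) \<longlonglongrightarrow> 0) \<and>
     (\<exists>d>0. (\<lambda>n. expected_posterior_mass_outside n
          (truncated_prior n (series_prior h (\<lambda>k. exp (- (ln (real k))\<^sup>2))))
          f0 (ln (real n) powr d * real n powr (- \<beta> / (2 * \<beta> + 1)))) \<longlonglongrightarrow> 0) \<and>
     (\<forall>\<alpha>>0. \<alpha> \<ge> \<beta> \<longrightarrow>
       (\<exists>d>0. (\<lambda>n. expected_posterior_mass_outside n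
            (series_prior h (\<lambda>k. real k powr (- 1 / 2 - \<alpha>)))
            f0 (ln (real n) powr d * real n powr (- \<beta> / (2 * \<beta> + 1)))) \<longlonglongrightarrow> 0) \<and>
       (\<exists>d>0. (\<lambda>n. expected_posterior_mass_outside n
            (truncated_prior n (series_prior h (\<lambda>k. real k powr (- 1 / 2 - \<alpha>))))
            f0 (ln (real n) powr d * real n powr (- \<beta> / (2 * \<beta> + 1)))) \<longlonglongrightarrow> 0))"
proof -
  have density: "symmetric_decreasing_density h"
    by unfold_locales (fact h_meas h_density h_sym h_pos h_decreasing h_second_moment)+
  have contraction: "(\<exists>d>0. (\<lambda>n. expected_posterior_mass_outside n (series_prior h \<sigma>)
          f0 (ln (real n) powr d * real n powr (- \<beta> / (2 * \<beta> + 1)))) \<longlonglongrightarrow> 0) \<and>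
     (\<exists>d>0. (\<lambda>n. expected_posterior_mass_outside n (truncated_prior n (series_prior h \<sigma>))
          f0 (ln (real n) powr d * real n powr (- \<beta> / (2 * \<beta> + 1)))) \<longlonglongrightarrow> 0)"
    if "0 \<le> A" and "\<And>k. 1 \<le> k \<Longrightarrow> 0 < \<sigma> k" and "\<And>k. 1 \<le> k \<Longrightarrow> \<sigma> k \<le> 1"
      and "\<And>k. 1 \<le> k \<Longrightarrow> \<sigma> k \<le> A * real k powr (- 1 / 2 - \<beta>)"
      and "\<And>k. 1 \<le> k \<Longrightarrow> ln (1 / \<sigma> k) \<le> A * (1 + ln (real k))\<^sup>2" for A \<sigma>
  proof -
    interpret heavy_tailed_prior h c1 \<kappa> \<beta> A L \<sigma> f0
      by (intro heavy_tailed_prior.intro heavy_tailed_prior_axioms.intro density c1 \<kappa> \<beta> h_tail f0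
          less_imp_le[OF L] that)
    obtain d where "0 < d" and d: "\<And>\<pi>. (\<forall>n k. 1 \<le> k \<longrightarrow> \<pi> n k = series_prior h \<sigma> k \<or> (n < k \<and> \<pi> n k = return borel 0)) \<Longrightarrow>
      (\<lambda>n. expected_posterior_mass_outside n (\<pi> n) f0
        (ln (real n) powr d * real n powr (- \<beta> / (2 * \<beta> + 1)))) \<longlonglongrightarrow> 0"
      using posterior_contraction by blast
    then show ?thesis
      using d[of "\<lambda>_. series_prior h \<sigma>"] d[of "\<lambda>n. truncated_prior n (series_prior h \<sigma>)"]
      by (auto simp: truncated_prior_def)
  qed
  show ?thesis
  proof (intro conjI[OF _ conjI] allI impI)
    let ?\<sigma> = "\<lambda>k. exp (- (ln (real k))\<^sup>2)"
    have 1: "?\<sigma> k \<le> exp ((1 / 2 + \<beta>)\<^sup>2) * real k powr (- 1 / 2 - \<beta>)" if "1 \<le> k" for k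
      using \<beta> that by (intro ln_square_prior_decay) auto
    have 2: "ln (1 / ?\<sigma> k) \<le> exp ((1 / 2 + \<beta>)\<^sup>2) * (1 + ln (real k))\<^sup>2" if "1 \<le> k" for k
    proof -
      \<comment> \<open>The constant from the decay condition is the exponential of a square, hence
        at least 1, and so it can also serve as \<open>A\<close> in the logarithmic
        condition.\<close>
      have "1 * (ln (real k))\<^sup>2 \<le> exp ((1 / 2 + \<beta>)\<^sup>2) * (1 + ln (real k))\<^sup>2"
        using that by (intro mult_mono power_mono) auto
      then show ?thesis by (simp add: ln_div)
    qed
    note both = contraction[of "exp ((1 / 2 + \<beta>)\<^sup>2)" ?\<sigma>, OF _ _ _ 1 2]
    show "\<exists>d>0. (\<lambda>n. expected_posterior_mass_outside n (series_prior h ?\<sigma>)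
          f0 (ln (real n) powr d * real n powr (- \<beta> / (2 * \<beta> + 1)))) \<longlonglongrightarrow> 0"
      by (rule conjunct1[OF both]) auto
    show "\<exists>d>0. (\<lambda>n. expected_posterior_mass_outside n (truncated_prior n (series_prior h ?\<sigma>))
          f0 (ln (real n) powr d * real n powr (- \<beta> / (2 * \<beta> + 1)))) \<longlonglongrightarrow> 0"
      by (rule conjunct2[OF both]) auto
  next
    fix \<alpha> :: real
    assume \<alpha>: "0 < \<alpha>" "\<alpha> \<ge> \<beta>"
    let ?\<sigma> = "\<lambda>k. real k powr (- 1 / 2 - \<alpha>)"
    show "(\<exists>d>0. (\<lambda>n. expected_posterior_mass_outside n (series_prior h ?\<sigma>)
          f0 (ln (real n) powr d * real n powr (- \<beta> / (2 * \<beta> + 1)))) \<longlonglongrightarrow> 0) \<and>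
       (\<exists>d>0. (\<lambda>n. expected_posterior_mass_outside n (truncated_prior n (series_prior h ?\<sigma>))
          f0 (ln (real n) powr d * real n powr (- \<beta> / (2 * \<beta> + 1)))) \<longlonglongrightarrow> 0)"
    \<comment> \<open>One constant has to dominate both 1, for the decay condition, and 1 / 2 +
      \<alpha>, for the logarithm of the scale.\<close>
    proof (rule contraction[of "1 + \<alpha>"])
      fix k :: nat
      assume k: "1 \<le> k"
      show "0 < ?\<sigma> k" using k by simp
      have "?\<sigma> k \<le> real k powr 0" using k \<alpha> by (intro powr_mono) auto
      then show "?\<sigma> k \<le> 1" using k by simp
      have "1 * ?\<sigma> k \<le> (1 + \<alpha>) * real k powr (- 1 / 2 - \<beta>)"
        using k \<alpha> by (intro mult_mono powr_mono) auto
      then show "?\<sigma> k \<le> (1 + \<alpha>) * real k powr (- 1 / 2 - \<beta>)" by simp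
      have lnk: "0 \<le> ln (real k)" using k by simp
      have "ln (1 / ?\<sigma> k) = (1 / 2 + \<alpha>) * ln (real k)"
        using k by (simp add: ln_div ln_powr algebra_simps)
      also have "\<dots> \<le> (1 + \<alpha>) * (1 + ln (real k))\<^sup>2"
        using lnk \<alpha> by (intro mult_mono) (auto simp: power2_eq_square algebra_simps)
      finally show "ln (1 / ?\<sigma> k) \<le> (1 + \<alpha>) * (1 + ln (real k))\<^sup>2" .
    qed (use \<alpha> in simp)
  qed
qed

end
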